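(* Let $c,d\in\mathbb N$ and let $\phi$ be a sentence of first-order logic with modulo counting ($\mathrm{FO}+\mathrm{MOD}$) over graphs. Let $P_\phi$ be the class of finite graphs satisfying $\phi$ and let $P:=P_\phi\cap\mathcal C^c_d$. Then $P$ is uniformly testable in constant time on $\mathcal C^c_d$: for every $\varepsilon\in(0,1]$ there is a randomised algorithm which, given $n$ and oracle access to a graph $G\in\mathcal C^c_d$ with vertex set $\{1,\dots,n\}$, accepts with probability at least $2/3$ if $G\in P$, rejects with probability at least $2/3$ if $G$ is $\varepsilon$-far from $P$, and whose running time is bounded by a constant independent of $n$ (depending only on $\varepsilon$, $c$, $d$ and $\phi$).
   Context: Graphs are finite, simple and undirected. $\mathcal C^c_d$ is the class of all graphs of maximum degree at most $d$ in which every connected component has at most $c$ vertices. $\mathrm{FO}+\mathrm{MOD}$ extends first-order logic over the edge relation (with equality, Boolean connectives and quantifiers over vertices) by modular counting quantifiers $\exists^{j(\mathrm{mod}\ \ell)}x\,\psi$ (for $j,\ell\in\mathbb N$, $j<\ell$), stating that the number of vertices $x$ satisfying $\psi$ is congruent to $j$ modulo $\ell$. Bounded degree model: the algorithm receives $n$ and may query an oracle with $(v,i)$, $v\in\{1,\dots,n\}$, $i\in\{1,\dots,d\}$, receiving in constant time the $i$-th neighbour of $v$ or a symbol $\bot$ if $v$ has fewer than $i$ neighbours. The distance between two graphs on $n$ vertices is the minimum number of edge insertions/deletions needed to make them isomorphic; two degree-$\le d$ graphs on $n$ vertices are $\varepsilon$-close if this distance is at most $\varepsilon d n$, and $G$ is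 $\varepsilon$-far from a property $P$ if it is not $\varepsilon$-close to any member of $P$ (with $n$ vertices). Running time is measured on a RAM with uniform cost (basic arithmetic and random sampling in constant time). *)

theory Defs
  imports "HOL-Probability.Probability_Mass_Function"
begin

section \<open>Finite simple graphs\<close>

record 'a ugraph =
  verts :: "'a set"
  edges :: "'a set set"

definition sgraph :: "'a ugraph \<Rightarrow> bool" where
  "sgraph G \<longleftrightarrow> finite (verts G) \<and> (\<forall>e\<in>edges G. e \<subseteq> verts G \<and> card e = 2)"

definition adj :: "'a ugraph \<Rightarrow> 'a \<Rightarrow> 'a \<Rightarrow> bool" where
  "adj G u v \<longleftrightarrow> {u, v} \<in> edges G"

definition neighbours :: "'a ugraph \<Rightarrow> 'a \<Rightarrow> 'a set" where
  "neighbours G v = {u. adj G v u}"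

definition degree :: "'a ugraph \<Rightarrow> 'a \<Rightarrow> nat" where
  "degree G v = card (neighbours G v)"

definition graph_components :: "'a ugraph \<Rightarrow> 'a set set" where
  "graph_components G = {{u. (adj G)\<^sup>*\<^sup>* v u} | v. v \<in> verts G}"

definition graph_iso :: "'a ugraph \<Rightarrow> 'b ugraph \<Rightarrow> bool" where
  "graph_iso G H \<longleftrightarrow> (\<exists>f. bij_betw f (verts G) (verts H) \<and>
     (\<forall>u\<in>verts G. \<forall>v\<in>verts G. adj G u v \<longleftrightarrow> adj H (f u) (f v)))"

text \<open>
  Vertices of concrete graphs are natural numbers; every finite graph is isomorphic to such a
  graph, and all properties considered are closed under isomorphism.
\<close>

definition bounded_component_graphs :: "nat \<Rightarrow> nat \<Rightarrow> nat ugraph set" where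
  "bounded_component_graphs c d =
     {G. sgraph G \<and> (\<forall>v\<in>verts G. degree G v \<le> d) \<and> (\<forall>C\<in>graph_components G. card C \<le> c)}"


section \<open>First-order logic with modulo counting\<close>

text \<open>
  Variables are natural numbers; \<open>FModEx j l x \<psi>\<close> says that the number of vertices \<open>x\<close>
  satisfying \<open>\<psi>\<close> is congruent to \<open>j\<close> modulo \<open>l\<close>.
\<close>

datatype fo_mod =
    FEq nat nat
  | FEdge nat nat
  | FNeg fo_mod
  | FConj fo_mod fo_mod
  | FDisj fo_mod fo_mod
  | FEx nat fo_mod
  | FAll nat fo_mod
  | FModEx nat nat nat fo_mod

primrec wf_fo_mod :: "fo_mod \<Rightarrow> bool" where
  "wf_fo_mod (FEq x y) \<longleftrightarrow> True"
| "wf_fo_mod (FEdge x y) \<longleftrightarrow> True"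
| "wf_fo_mod (FNeg \<psi>) \<longleftrightarrow> wf_fo_mod \<psi>"
| "wf_fo_mod (FConj \<psi> \<theta>) \<longleftrightarrow> wf_fo_mod \<psi> \<and> wf_fo_mod \<theta>"
| "wf_fo_mod (FDisj \<psi> \<theta>) \<longleftrightarrow> wf_fo_mod \<psi> \<and> wf_fo_mod \<theta>"
| "wf_fo_mod (FEx x \<psi>) \<longleftrightarrow> wf_fo_mod \<psi>"
| "wf_fo_mod (FAll x \<psi>) \<longleftrightarrow> wf_fo_mod \<psi>"
| "wf_fo_mod (FModEx j l x \<psi>) \<longleftrightarrow> j < l \<and> wf_fo_mod \<psi>"

primrec free_vars :: "fo_mod \<Rightarrow> nat set" where
  "free_vars (FEq x y) = {x, y}"
| "free_vars (FEdge x y) = {x, y}"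
| "free_vars (FNeg \<psi>) = free_vars \<psi>"
| "free_vars (FConj \<psi> \<theta>) = free_vars \<psi> \<union> free_vars \<theta>"
| "free_vars (FDisj \<psi> \<theta>) = free_vars \<psi> \<union> free_vars \<theta>"
| "free_vars (FEx x \<psi>) = free_vars \<psi> - {x}"
| "free_vars (FAll x \<psi>) = free_vars \<psi> - {x}"
| "free_vars (FModEx j l x \<psi>) = free_vars \<psi> - {x}"

primrec sat :: "'a ugraph \<Rightarrow> (nat \<Rightarrow> 'a) \<Rightarrow> fo_mod \<Rightarrow> bool" where
  "sat G \<sigma> (FEq x y) \<longleftrightarrow> \<sigma> x = \<sigma> y"
| "sat G \<sigma> (FEdge x y) \<longleftrightarrow> adj G (\<sigma> x) (\<sigma> y)"
| "sat G \<sigma> (FNeg \<psi>) \<longleftrightarrow> \<not> sat G \<sigma> \<psi>"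
| "sat G \<sigma> (FConj \<psi> \<theta>) \<longleftrightarrow> sat G \<sigma> \<psi> \<and> sat G \<sigma> \<theta>"
| "sat G \<sigma> (FDisj \<psi> \<theta>) \<longleftrightarrow> sat G \<sigma> \<psi> \<or> sat G \<sigma> \<theta>"
| "sat G \<sigma> (FEx x \<psi>) \<longleftrightarrow> (\<exists>a\<in>verts G. sat G (\<sigma>(x := a)) \<psi>)"
| "sat G \<sigma> (FAll x \<psi>) \<longleftrightarrow> (\<forall>a\<in>verts G. sat G (\<sigma>(x := a)) \<psi>)"
| "sat G \<sigma> (FModEx j l x \<psi>) \<longleftrightarrow> card {a \<in> verts G. sat G (\<sigma>(x := a)) \<psi>} mod l = j mod l"

definition sentence :: "fo_mod \<Rightarrow> bool" where
  "sentence \<phi> \<longleftrightarrow> wf_fo_mod \<phi> \<and> free_vars \<phi> = {}"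

text \<open>For a sentence the quantification over the assignment \<open>\<sigma>\<close> is vacuous.\<close>

definition property_of :: "fo_mod \<Rightarrow> nat ugraph set" where
  "property_of \<phi> = {G. sgraph G \<and> (\<forall>\<sigma>. sat G \<sigma> \<phi>)}"


section \<open>Distance between graphs\<close>

text \<open>
  Turning \<open>G\<close> into a graph \<open>F\<close> on the same vertices takes one insertion for each edge of \<open>F\<close>
  missing in \<open>G\<close> and one deletion for each edge of \<open>G\<close> missing in \<open>F\<close>. The distance is only
  meaningful for graphs with equally many vertices.
\<close>

definition edit_cost :: "'a ugraph \<Rightarrow> 'a ugraph \<Rightarrow> nat" where
  "edit_cost G F = card (edges F - edges G) + card (edges G - edges F)"

definition graph_dist :: "'a ugraph \<Rightarrow> 'b ugraph \<Rightarrow> nat" where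
  "graph_dist G H =
     (LEAST k. \<exists>F. sgraph F \<and> verts F = verts G \<and> graph_iso F H \<and> edit_cost G F = k)"

definition eps_close :: "real \<Rightarrow> nat \<Rightarrow> 'a ugraph \<Rightarrow> 'b ugraph \<Rightarrow> bool" where
  "eps_close \<epsilon> d G H \<longleftrightarrow> card (verts G) = card (verts H) \<and>
     real (graph_dist G H) \<le> \<epsilon> * real d * real (card (verts G))"

definition eps_far :: "real \<Rightarrow> nat \<Rightarrow> 'a ugraph \<Rightarrow> 'b ugraph set \<Rightarrow> bool" where
  "eps_far \<epsilon> d G P \<longleftrightarrow> \<not> (\<exists>H\<in>P. eps_close \<epsilon> d G H)"


section \<open>Randomised random access machines with a neighbour oracle\<close>

text \<open>
  An oracle answers a query \<open>(v, i)\<close> by \<open>Some u\<close> or, for the symbol \<open>\<bottom>\<close>, by \<open>None\<close>. The order in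
  which the neighbours of a vertex are listed is arbitrary, and so are the answers to queries
  outside \<open>{1..n} \<times> {1..d}\<close>.
\<close>

type_synonym oracle_fun = "nat \<Rightarrow> nat \<Rightarrow> nat option"

definition oracle_for :: "nat \<Rightarrow> nat ugraph \<Rightarrow> oracle_fun \<Rightarrow> bool" where
  "oracle_for d G orc \<longleftrightarrow> (\<forall>v\<in>verts G. \<exists>f.
     bij_betw f {1..degree G v} (neighbours G v) \<and>
     (\<forall>i\<in>{1..d}. orc v i = (if i \<le> degree G v then Some (f i) else None)))"

text \<open>
  Registers are indexed by and contain natural numbers. Arguments of type \<open>nat\<close> are register
  indices, except for the constant in \<open>Const\<close> and the target address \<open>l\<close> of a jump.
  \<open>Load r a\<close> and \<open>Store a b\<close> use indirect addressing. \<open>Sample r a\<close> draws uniformly from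
  \<open>{1..m}\<close>, where \<open>m\<close> is the content of register \<open>a\<close> (and yields 0 if \<open>m = 0\<close>).
\<close>

datatype instr =
    Const nat nat
  | Copy nat nat
  | Add nat nat nat
  | Sub nat nat nat
  | Mul nat nat nat
  | Div nat nat nat
  | Mod nat nat nat
  | Load nat nat
  | Store nat nat
  | Sample nat nat
  | Query nat nat nat
  | Jump nat
  | JumpEq nat nat nat
  | JumpLess nat nat nat
  | Accept
  | Reject

type_synonym config = "nat \<times> (nat \<Rightarrow> nat)"

definition uniform_upto :: "nat \<Rightarrow> nat pmf" where
  "uniform_upto m = (if m = 0 then return_pmf 0 else pmf_of_set {1..m})"

text \<open>The answer \<open>\<bottom>\<close> is stored as 0, which is not a vertex.\<close>

fun exec :: "oracle_fun \<Rightarrow> instr \<Rightarrow> config \<Rightarrow> config pmf" where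
  "exec orc (Const r k) (pc, m) = return_pmf (Suc pc, m(r := k))"
| "exec orc (Copy r a) (pc, m) = return_pmf (Suc pc, m(r := m a))"
| "exec orc (Add r a b) (pc, m) = return_pmf (Suc pc, m(r := m a + m b))"
| "exec orc (Sub r a b) (pc, m) = return_pmf (Suc pc, m(r := m a - m b))"
| "exec orc (Mul r a b) (pc, m) = return_pmf (Suc pc, m(r := m a * m b))"
| "exec orc (Div r a b) (pc, m) = return_pmf (Suc pc, m(r := m a div m b))"
| "exec orc (Mod r a b) (pc, m) = return_pmf (Suc pc, m(r := m a mod m b))"
| "exec orc (Load r a) (pc, m) = return_pmf (Suc pc, m(r := m (m a)))"
| "exec orc (Store a b) (pc, m) = return_pmf (Suc pc, m(m a := m b))"
| "exec orc (Sample r a) (pc, m) = map_pmf (\<lambda>x. (Suc pc, m(r := x))) (uniform_upto (m a))"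
| "exec orc (Query r a b) (pc, m) =
     return_pmf (Suc pc, m(r := (case orc (m a) (m b) of Some u \<Rightarrow> u | None \<Rightarrow> 0)))"
| "exec orc (Jump l) (pc, m) = return_pmf (l, m)"
| "exec orc (JumpEq a b l) (pc, m) = return_pmf (if m a = m b then l else Suc pc, m)"
| "exec orc (JumpLess a b l) (pc, m) = return_pmf (if m a < m b then l else Suc pc, m)"
| "exec orc Accept (pc, m) = return_pmf (pc, m)"
| "exec orc Reject (pc, m) = return_pmf (pc, m)"

text \<open>A machine whose program counter leaves the program is stuck without a verdict.\<close>

definition step :: "oracle_fun \<Rightarrow> instr list \<Rightarrow> config \<Rightarrow> config pmf" where
  "step orc p s = (if fst s < length p then exec orc (p ! fst s) s else return_pmf s)"

primrec run :: "oracle_fun \<Rightarrow> instr list \<Rightarrow> nat \<Rightarrow> config \<Rightarrow> config pmf" where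
  "run orc p 0 s = return_pmf s"
| "run orc p (Suc t) s = bind_pmf (step orc p s) (run orc p t)"

definition accepting :: "instr list \<Rightarrow> config \<Rightarrow> bool" where
  "accepting p s \<longleftrightarrow> fst s < length p \<and> p ! fst s = Accept"

definition rejecting :: "instr list \<Rightarrow> config \<Rightarrow> bool" where
  "rejecting p s \<longleftrightarrow> fst s < length p \<and> p ! fst s = Reject"

text \<open>The input \<open>n\<close> is passed in register 0; all other registers are initially 0.\<close>

definition initial :: "nat \<Rightarrow> config" where
  "initial n = (0, (\<lambda>_. 0)(0 := n))"


section \<open>Uniform testability in constant time\<close>

text \<open>
  Every instruction costs one time unit. The time bound \<open>T\<close> is a worst-case bound over all
  inputs and all random choices: after \<open>T\<close> steps the machine has reached a verdict with
  certainty, and since \<open>Accept\<close> and \<open>Reject\<close> are halting, the verdict is final.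
\<close>

definition uniformly_testable_const_time ::
  "nat \<Rightarrow> nat ugraph set \<Rightarrow> nat ugraph set \<Rightarrow> bool" where
  "uniformly_testable_const_time d P K \<longleftrightarrow>
     (\<forall>\<epsilon>::real. 0 < \<epsilon> \<and> \<epsilon> \<le> 1 \<longrightarrow>
       (\<exists>(p :: instr list) (T :: nat). \<forall>n G orc.
          G \<in> K \<and> verts G = {1..n} \<and> oracle_for d G orc \<longrightarrow>
          (\<forall>s\<in>set_pmf (run orc p T (initial n)). accepting p s \<or> rejecting p s) \<and>
          (G \<in> P \<longrightarrow>
             measure_pmf.prob (run orc p T (initial n)) {s. accepting p s} \<ge> 2 / 3) \<and>
          (eps_far \<epsilon> d G P \<longrightarrow>
             measure_pmf.prob (run orc p T (initial n)) {s. rejecting p s} \<ge> 2 / 3)))"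

end

theory Submission
  imports Defs "HOL-Probability.Product_PMF"
begin

text \<open>
  A graph in the class is a disjoint union of components of finitely many types, so it is given by
  the number of copies of each type. Swapping an added copy with an old one that no variable has
  touched shows that the truth of \<open>\<phi>\<close> depends on each of these numbers only up to a threshold
  (the quantifier depth) and modulo the product of the moduli of \<open>\<phi>\<close>.

  For large \<open>n\<close> the tester samples vertices, explores their components, and accepts if some model of
  \<open>\<phi>\<close> of size congruent to \<open>n\<close> contains each type seen at least threshold many times. On a graph with
  the property, types below the threshold are too rare to be sampled. Conversely, with high
  probability all frequent types are seen; then the counts of the witnessing model can be moved close
  to those of the input within their equivalence classes, and only few vertices have to be rewired.
  For small \<open>n\<close> the whole graph is queried.

  On the machine, the answer depends only on which of the values obtained by a fixed finite set of
  nested queries coincide, and this pattern is determined by a loop-free program.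
\<close>

section \<open>Isomorphisms and satisfaction\<close>

text \<open>The vertex count shapes the argument. The rewired graph must have exactly
  \<open>n\<close> vertices, while a count above the threshold may move only in steps of the modulus
  and a count below it not at all. Two sources of slack remain. A type missing from the sample may
  have to be cut down to a few copies, which is cheap because it is probably rare. And by the
  pigeonhole principle one of the \<open>m\<close> types fills at least \<open>n / m\<close>
  vertices; it can absorb the total error of the others, a small fraction of \<open>n\<close>. Its
  own count changes by a multiple of the modulus only if the discrepancy is divisible by that
  modulus times its size, whence the factor \<open>fact c\<close> in the residue condition on
  \<open>n\<close>. The program does not implement the acceptance condition. It may depend on
  \<epsilon>, c, d and \<phi>, so the verdicts for the finitely many patterns are tabulated when it
  is constructed. As vertex names are unbounded, such a table can be indexed by coincidences between
  values but not by the values.\<close>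

definition is_iso :: "('a \<Rightarrow> 'b) \<Rightarrow> 'a ugraph \<Rightarrow> 'b ugraph \<Rightarrow> bool" where
  "is_iso f G H \<longleftrightarrow> bij_betw f (verts G) (verts H) \<and>
     (\<forall>u\<in>verts G. \<forall>v\<in>verts G. adj G u v \<longleftrightarrow> adj H (f u) (f v))"

lemma graph_iso_iff: "graph_iso G H \<longleftrightarrow> (\<exists>f. is_iso f G H)"
  by (simp add: graph_iso_def is_iso_def)

lemma is_iso_mem: "is_iso f G H \<Longrightarrow> v \<in> verts G \<Longrightarrow> f v \<in> verts H"
  by (auto simp: is_iso_def bij_betw_def)

lemma is_iso_adj:
  "is_iso f G H \<Longrightarrow> u \<in> verts G \<Longrightarrow> v \<in> verts G \<Longrightarrow> adj H (f u) (f v) \<longleftrightarrow> adj G u v"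
  by (auto simp: is_iso_def)

lemma is_iso_inv:
  assumes "is_iso f G H"
  shows "is_iso (inv_into (verts G) f) H G"
proof -
  have b: "bij_betw f (verts G) (verts H)" using assms by (simp add: is_iso_def)
  have "inv_into (verts G) f v \<in> verts G" "f (inv_into (verts G) f v) = v" if "v \<in> verts H" for v
    using that b by (auto simp: bij_betw_def inv_into_into f_inv_into_f)
  then show ?thesis
    using bij_betw_inv_into[OF b] assms unfolding is_iso_def by metis
qed

lemma is_iso_comp: "is_iso f G H \<Longrightarrow> is_iso g H K \<Longrightarrow> is_iso (g \<circ> f) G K"
  unfolding is_iso_def by (auto intro: bij_betw_trans simp: bij_betw_apply)

lemma graph_iso_sym: "graph_iso G H \<Longrightarrow> graph_iso H G"
  using is_iso_inv graph_iso_iff by metis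

lemma graph_iso_trans: "graph_iso G H \<Longrightarrow> graph_iso H K \<Longrightarrow> graph_iso G K"
  using is_iso_comp graph_iso_iff by metis

text \<open>Constraining only the free variables lets the induction pass under a quantifier, where
  the old value of the bound variable is arbitrary, and lets sentences be compared under unrelated
  assignments.\<close>

lemma sat_iso:
  assumes "is_iso f G H" and "\<And>y. y \<in> free_vars \<psi> \<Longrightarrow> \<sigma> y \<in> verts G \<and> \<tau> y = f (\<sigma> y)"
  shows "sat G \<sigma> \<psi> \<longleftrightarrow> sat H \<tau> \<psi>"
  using assms(2)
proof (induction \<psi> arbitrary: \<sigma> \<tau>)
  case (FEq x y)
  then show ?case using assms(1) by (auto simp: is_iso_def bij_betw_def inj_on_def)
next
  case (FEdge x y)
  then show ?case using is_iso_adj[OF assms(1)] by auto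
next
  case (FNeg \<psi>)
  have "sat G \<sigma> \<psi> \<longleftrightarrow> sat H \<tau> \<psi>" by (intro FNeg.IH FNeg.prems; simp)
  then show ?case by simp
next
  case (FConj \<psi> \<theta>)
  have "sat G \<sigma> \<psi> \<longleftrightarrow> sat H \<tau> \<psi>" "sat G \<sigma> \<theta> \<longleftrightarrow> sat H \<tau> \<theta>"
    by (intro FConj.IH FConj.prems; simp)+
  then show ?case by simp
next
  case (FDisj \<psi> \<theta>)
  have "sat G \<sigma> \<psi> \<longleftrightarrow> sat H \<tau> \<psi>" "sat G \<sigma> \<theta> \<longleftrightarrow> sat H \<tau> \<theta>"
    by (intro FDisj.IH FDisj.prems; simp)+
  then show ?case by simp
next
  case (FEx x \<psi>)
  have "sat G (\<sigma>(x := a)) \<psi> \<longleftrightarrow> sat H (\<tau>(x := f a)) \<psi>" if "a \<in> verts G" for a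
    by (rule FEx.IH) (use FEx.prems that in auto)
  moreover have "verts H = f ` verts G" using assms(1) by (simp add: is_iso_def bij_betw_def)
  ultimately show ?case by auto
next
  case (FAll x \<psi>)
  have "sat G (\<sigma>(x := a)) \<psi> \<longleftrightarrow> sat H (\<tau>(x := f a)) \<psi>" if "a \<in> verts G" for a
    by (rule FAll.IH) (use FAll.prems that in auto)
  moreover have "verts H = f ` verts G" using assms(1) by (simp add: is_iso_def bij_betw_def)
  ultimately show ?case by auto
next
  case (FModEx j l x \<psi>)
  have *: "sat G (\<sigma>(x := a)) \<psi> \<longleftrightarrow> sat H (\<tau>(x := f a)) \<psi>" if "a \<in> verts G" for a
    by (rule FModEx.IH) (use FModEx.prems that in auto)
  have im: "verts H = f ` verts G" and inj: "inj_on f (verts G)"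
    using assms(1) by (auto simp: is_iso_def bij_betw_def)
  have "{b \<in> verts H. sat H (\<tau>(x := b)) \<psi>} = f ` {a \<in> verts G. sat G (\<sigma>(x := a)) \<psi>}"
    using * im by auto
  moreover have "inj_on f {a \<in> verts G. sat G (\<sigma>(x := a)) \<psi>}"
    using inj by (rule inj_on_subset) auto
  ultimately show ?case by (simp add: card_image)
qed

text \<open>\<open>property_of\<close> speaks of graphs on natural numbers, whereas the vertices of
  \<open>copies x\<close> are triples.\<close>

definition models :: "'a ugraph \<Rightarrow> fo_mod \<Rightarrow> bool" where
  "models G \<phi> \<longleftrightarrow> (\<forall>\<sigma>. sat G \<sigma> \<phi>)"

lemma models_iso:
  assumes "graph_iso G H" "sentence \<phi>"
  shows "models G \<phi> \<longleftrightarrow> models H \<phi>"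
proof -
  obtain f where "is_iso f G H" using assms(1) graph_iso_iff by blast
  then have "sat G \<sigma> \<phi> = sat H \<tau> \<phi>" for \<sigma> \<tau>
    by (rule sat_iso) (use assms(2) in \<open>simp add: sentence_def\<close>)
  then show ?thesis unfolding models_def by blast
qed

section \<open>Disjoint unions of copies\<close>

text \<open>\<open>(T, k, v)\<close> is the vertex \<open>v\<close> of copy number \<open>k\<close>
  of \<open>T\<close>. Numbering the copies from 0 makes unions with different counts overlap in as
  many copies as possible, which serves both for adding copies and for rewiring.\<close>

definition copies :: "('i ugraph \<Rightarrow> nat) \<Rightarrow> ('i ugraph \<times> nat \<times> 'i) ugraph" where
  "copies x = \<lparr>verts = {(T, k, v). k < x T \<and> v \<in> verts T},
     edges = {{(T, k, u), (T, k, v)} | T k u v. k < x T \<and> {u, v} \<in> edges T}\<rparr>"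

lemma verts_copies: "(T, k, v) \<in> verts (copies x) \<longleftrightarrow> k < x T \<and> v \<in> verts T"
  by (simp add: copies_def)

lemma adj_commute: "adj G u v \<longleftrightarrow> adj G v u"
  by (simp add: adj_def insert_commute)

lemma adj_copies:
  "adj (copies x) (T, k, u) (S, l, v) \<longleftrightarrow> T = S \<and> k = l \<and> k < x T \<and> adj T u v"
proof
  assume "adj (copies x) (T, k, u) (S, l, v)"
  then obtain T' k' u' v' where "k' < x T'" "{u', v'} \<in> edges T'"
      and "{(T, k, u), (S, l, v)} = {(T', k', u'), (T', k', v')}"
    by (auto simp: adj_def copies_def)
  then show "T = S \<and> k = l \<and> k < x T \<and> adj T u v"
    by (auto simp: adj_def doubleton_eq_iff insert_commute)
qed (auto simp: adj_def copies_def)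

section \<open>Dependence of the truth of a formula on the numbers of copies\<close>

primrec qdepth :: "fo_mod \<Rightarrow> nat" where
  "qdepth (FEq x y) = 0"
| "qdepth (FEdge x y) = 0"
| "qdepth (FNeg \<psi>) = qdepth \<psi>"
| "qdepth (FConj \<psi> \<theta>) = max (qdepth \<psi>) (qdepth \<theta>)"
| "qdepth (FDisj \<psi> \<theta>) = max (qdepth \<psi>) (qdepth \<theta>)"
| "qdepth (FEx x \<psi>) = Suc (qdepth \<psi>)"
| "qdepth (FAll x \<psi>) = Suc (qdepth \<psi>)"
| "qdepth (FModEx j l x \<psi>) = Suc (qdepth \<psi>)"

primrec modulus :: "fo_mod \<Rightarrow> nat" where
  "modulus (FEq x y) = 1"
| "modulus (FEdge x y) = 1"
| "modulus (FNeg \<psi>) = modulus \<psi>"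
| "modulus (FConj \<psi> \<theta>) = modulus \<psi> * modulus \<theta>"
| "modulus (FDisj \<psi> \<theta>) = modulus \<psi> * modulus \<theta>"
| "modulus (FEx x \<psi>) = modulus \<psi>"
| "modulus (FAll x \<psi>) = modulus \<psi>"
| "modulus (FModEx j l x \<psi>) = l * modulus \<psi>"

lemma modulus_pos: "wf_fo_mod \<psi> \<Longrightarrow> modulus \<psi> > 0"
  by (induction \<psi>) auto

definition untouched :: "('i ugraph \<Rightarrow> nat) \<Rightarrow> 'i ugraph \<Rightarrow> nat set \<Rightarrow>
    (nat \<Rightarrow> 'i ugraph \<times> nat \<times> 'i) \<Rightarrow> nat set" where
  "untouched x T X \<sigma> = {k. k < x T \<and> (\<forall>y\<in>X. \<forall>v. \<sigma> y \<noteq> (T, k, v))}"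

lemma finite_untouched: "finite (untouched x T X \<sigma>)"
  by (simp add: untouched_def)

lemma card_untouched_mono: "X \<subseteq> Y \<Longrightarrow> card (untouched x T Y \<sigma>) \<le> card (untouched x T X \<sigma>)"
  by (rule card_mono[OF finite_untouched]) (auto simp: untouched_def)

text \<open>A vertex lies in one copy, so assigning a variable touches at most one further copy.
  This is the unit by which \<open>qdepth\<close> drops under a quantifier.\<close>

lemma card_untouched_upd:
  "card (untouched x T (X - {y}) \<sigma>) \<le> Suc (card (untouched x T X (\<sigma>(y := a))))"
proof -
  have "untouched x T (X - {y}) \<sigma> \<subseteq> insert (fst (snd a)) (untouched x T X (\<sigma>(y := a)))"
    by (auto simp: untouched_def)
  then have "card (untouched x T (X - {y}) \<sigma>) \<le>
      card (insert (fst (snd a)) (untouched x T X (\<sigma>(y := a))))"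
    by (rule card_mono[rotated]) (simp add: finite_untouched)
  then show ?thesis by (simp add: card_insert_if finite_untouched split: if_splits)
qed

definition swap_copies ::
  "'i ugraph \<Rightarrow> nat \<Rightarrow> nat \<Rightarrow> 'i ugraph \<times> nat \<times> 'i \<Rightarrow> 'i ugraph \<times> nat \<times> 'i" where
  "swap_copies T k l = (\<lambda>(S, i, v). (S, if S = T then (if i = k then l else if i = l then k else i) else i, v))"

lemma is_iso_swap_copies:
  assumes "k < x T" "l < x T"
  shows "is_iso (swap_copies T k l) (copies x) (copies x)"
  unfolding is_iso_def
proof (intro conjI ballI)
  have inv: "swap_copies T k l (swap_copies T k l a) = a" for a
    by (auto simp: swap_copies_def split: prod.splits if_splits)
  have mem: "swap_copies T k l a \<in> verts (copies x)" if "a \<in> verts (copies x)" for a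
    using that assms by (cases a) (auto simp: swap_copies_def verts_copies)
  show "bij_betw (swap_copies T k l) (verts (copies x)) (verts (copies x))"
    by (rule bij_betw_byWitness[where f' = "swap_copies T k l"]) (use inv mem in auto)
  fix a b
  show "adj (copies x) a b = adj (copies x) (swap_copies T k l a) (swap_copies T k l b)"
    using assms by (cases a; cases b) (auto simp: swap_copies_def adj_copies)
qed

lemma mod_add_dvd: "(l::nat) dvd b \<Longrightarrow> (a + b) mod l = a mod l"
  by (elim dvdE) simp

lemma ball_bex_transfer:
  assumes "A \<subseteq> B" "\<forall>a\<in>A. P a \<longleftrightarrow> Q a" "\<And>b. b \<in> B \<Longrightarrow> \<exists>a\<in>A. Q b \<longleftrightarrow> P a"
  shows "(\<exists>a\<in>A. P a) \<longleftrightarrow> (\<exists>b\<in>B. Q b)" "(\<forall>a\<in>A. P a) \<longleftrightarrow> (\<forall>b\<in>B. Q b)"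
  using assms by (meson subsetD)+

text \<open>
  A vertex of one of the \<open>z\<close> added copies of \<open>T\<close> can be swapped into an untouched old copy, so
  each added copy contains the same number of witnesses of a quantifier.
\<close>

lemma sat_add_copies:
  fixes T :: "'i ugraph"
  assumes fin: "finite (verts T)"
    and "\<And>y. y \<in> free_vars \<psi> \<Longrightarrow> \<sigma> y \<in> verts (copies x)"
    and "qdepth \<psi> \<le> card (untouched x T (free_vars \<psi>) \<sigma>)"
    and "modulus \<psi> dvd z" and finx: "finite (verts (copies x))"
    and G: "G = copies x" and G': "G' = copies (x(T := x T + z))"
  shows "sat G \<sigma> \<psi> \<longleftrightarrow> sat G' \<sigma> \<psi>"
  using assms(2,3,4)[folded G]
proof (induction \<psi> arbitrary: \<sigma>)
  have sub: "verts G \<subseteq> verts G'"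
    by (auto simp: G G' verts_copies)
  have new: "a \<in> verts G' \<and> a \<notin> verts G \<longleftrightarrow> (\<exists>k v. a = (T, k, v) \<and> x T \<le> k \<and> k < x T + z \<and> v \<in> verts T)" for a
    by (cases a) (auto simp: G G' verts_copies)
  \<comment> \<open>\<open>k0\<close> is chosen before \<open>k\<close>. The other free variables
    have values in old copies, hence outside copy \<open>k\<close>, and they avoid copy
    \<open>k0\<close>; so the swap fixes them, and one \<open>k0\<close> serves every added
    copy.\<close>
  have swap: "\<exists>k0<x T. \<forall>k v. x T \<le> k \<longrightarrow> k < x T + z \<longrightarrow> v \<in> verts T \<longrightarrow>
        (sat G' (\<sigma>(y := (T, k, v))) \<psi> \<longleftrightarrow> sat G' (\<sigma>(y := (T, k0, v))) \<psi>)"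
    if fv: "\<And>w. w \<in> free_vars \<psi> - {y} \<Longrightarrow> \<sigma> w \<in> verts G"
      and qd: "Suc (qdepth \<psi>) \<le> card (untouched x T (free_vars \<psi> - {y}) \<sigma>)" for \<psi> y \<sigma>
  proof -
    have "untouched x T (free_vars \<psi> - {y}) \<sigma> \<noteq> {}" using qd by auto
    then obtain k0 where k0: "k0 < x T" "\<And>w v. w \<in> free_vars \<psi> - {y} \<Longrightarrow> \<sigma> w \<noteq> (T, k0, v)"
      by (auto simp: untouched_def)
    have "sat G' (\<sigma>(y := (T, k, v))) \<psi> \<longleftrightarrow> sat G' (\<sigma>(y := (T, k0, v))) \<psi>"
      if k: "x T \<le> k" "k < x T + z" and v: "v \<in> verts T" for k v
    proof (rule sat_iso)
      show "is_iso (swap_copies T k k0) G' G'"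
        unfolding G' by (rule is_iso_swap_copies) (use k k0 in auto)
      fix w assume w: "w \<in> free_vars \<psi>"
      show "(\<sigma>(y := (T, k, v))) w \<in> verts G' \<and>
          (\<sigma>(y := (T, k0, v))) w = swap_copies T k k0 ((\<sigma>(y := (T, k, v))) w)"
      proof (cases "w = y")
        case True
        then show ?thesis using k v by (auto simp: G' verts_copies swap_copies_def)
      next
        case False
        then have w': "w \<in> free_vars \<psi> - {y}" using w by auto
        obtain S i u where s: "\<sigma> w = (S, i, u)" by (cases "\<sigma> w")
        have "i < x S" "u \<in> verts S" using fv[OF w'] s by (auto simp: G verts_copies)
        moreover have "\<not> (S = T \<and> i = k0)" using k0(2)[OF w'] s by auto
        ultimately show ?thesis using False s k by (auto simp: G' verts_copies swap_copies_def)
      qed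
    qed
    then show "\<exists>k0<x T. \<forall>k v. x T \<le> k \<longrightarrow> k < x T + z \<longrightarrow> v \<in> verts T \<longrightarrow>
        (sat G' (\<sigma>(y := (T, k, v))) \<psi> \<longleftrightarrow> sat G' (\<sigma>(y := (T, k0, v))) \<psi>)"
      using k0(1) by blast
  qed
  {
    case (FEq y w)
    then show ?case by simp
  next
    case (FEdge y w)
    then have "\<sigma> y \<in> verts G" "\<sigma> w \<in> verts G" by auto
    then show ?case
      by (cases "\<sigma> y"; cases "\<sigma> w") (auto simp: G G' adj_copies verts_copies)
  next
    case (FNeg \<psi>)
    then show ?case by simp
  next
    case (FConj \<psi> \<theta>)
    have "sat G \<sigma> \<psi> \<longleftrightarrow> sat G' \<sigma> \<psi>"
      using FConj.prems card_untouched_mono[of "free_vars \<psi>" "free_vars (FConj \<psi> \<theta>)" x T \<sigma>]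
      by (intro FConj.IH) (auto intro: dvd_mult_left)
    moreover have "sat G \<sigma> \<theta> \<longleftrightarrow> sat G' \<sigma> \<theta>"
      using FConj.prems card_untouched_mono[of "free_vars \<theta>" "free_vars (FConj \<psi> \<theta>)" x T \<sigma>]
      by (intro FConj.IH) (auto intro: dvd_mult_right)
    ultimately show ?case unfolding sat.simps by blast
  next
    case (FDisj \<psi> \<theta>)
    have "sat G \<sigma> \<psi> \<longleftrightarrow> sat G' \<sigma> \<psi>"
      using FDisj.prems card_untouched_mono[of "free_vars \<psi>" "free_vars (FDisj \<psi> \<theta>)" x T \<sigma>]
      by (intro FDisj.IH) (auto intro: dvd_mult_left)
    moreover have "sat G \<sigma> \<theta> \<longleftrightarrow> sat G' \<sigma> \<theta>"
      using FDisj.prems card_untouched_mono[of "free_vars \<theta>" "free_vars (FDisj \<psi> \<theta>)" x T \<sigma>]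
      by (intro FDisj.IH) (auto intro: dvd_mult_right)
    ultimately show ?case unfolding sat.simps by blast
  next
    case (FEx y \<psi>)
    \<comment> \<open>The quantifier's share of \<open>qdepth\<close> pays for the copy that
      \<open>a\<close> may touch.\<close>
    have old: "\<forall>a\<in>verts G. sat G (\<sigma>(y := a)) \<psi> \<longleftrightarrow> sat G' (\<sigma>(y := a)) \<psi>"
    proof
      fix a assume a: "a \<in> verts G"
      show "sat G (\<sigma>(y := a)) \<psi> \<longleftrightarrow> sat G' (\<sigma>(y := a)) \<psi>"
      proof (rule FEx.IH)
        show "qdepth \<psi> \<le> card (untouched x T (free_vars \<psi>) (\<sigma>(y := a)))"
          using FEx.prems(2) card_untouched_upd[of x T "free_vars \<psi>" y \<sigma> a] by simp
      qed (use a FEx.prems in auto)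
    qed
    obtain k0 where k0: "k0 < x T" "\<And>k v. x T \<le> k \<Longrightarrow> k < x T + z \<Longrightarrow> v \<in> verts T \<Longrightarrow>
        sat G' (\<sigma>(y := (T, k, v))) \<psi> \<longleftrightarrow> sat G' (\<sigma>(y := (T, k0, v))) \<psi>"
      using swap[of \<psi> y \<sigma>, OF FEx.prems(1)] FEx.prems(2) unfolding free_vars.simps qdepth.simps by blast
    have "\<exists>b\<in>verts G. sat G' (\<sigma>(y := a)) \<psi> \<longleftrightarrow> sat G (\<sigma>(y := b)) \<psi>" if a: "a \<in> verts G'" for a
    proof (cases "a \<in> verts G")
      case True
      show ?thesis
      proof (rule bexI)
        show "sat G' (\<sigma>(y := a)) \<psi> \<longleftrightarrow> sat G (\<sigma>(y := a)) \<psi>"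
          by (rule sym[OF bspec[OF old True]])
      qed (rule True)
    next
      case False
      then obtain k v where a': "a = (T, k, v)" "x T \<le> k" "k < x T + z" "v \<in> verts T"
        using new a by blast
      have m: "(T, k0, v) \<in> verts G" using k0(1) a'(4) by (simp add: G verts_copies)
      show ?thesis unfolding a'(1)
      proof (rule bexI)
        show "sat G' (\<sigma>(y := (T, k, v))) \<psi> \<longleftrightarrow> sat G (\<sigma>(y := (T, k0, v))) \<psi>"
          by (rule trans[OF k0(2)[OF a'(2-4)] sym[OF bspec[OF old m]]])
      qed (rule m)
    qed
    then show ?case unfolding sat.simps by (rule ball_bex_transfer[OF sub old])
  next
    case (FAll y \<psi>)
    have old: "\<forall>a\<in>verts G. sat G (\<sigma>(y := a)) \<psi> \<longleftrightarrow> sat G' (\<sigma>(y := a)) \<psi>"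
    proof
      fix a assume a: "a \<in> verts G"
      show "sat G (\<sigma>(y := a)) \<psi> \<longleftrightarrow> sat G' (\<sigma>(y := a)) \<psi>"
      proof (rule FAll.IH)
        show "qdepth \<psi> \<le> card (untouched x T (free_vars \<psi>) (\<sigma>(y := a)))"
          using FAll.prems(2) card_untouched_upd[of x T "free_vars \<psi>" y \<sigma> a] by simp
      qed (use a FAll.prems in auto)
    qed
    obtain k0 where k0: "k0 < x T" "\<And>k v. x T \<le> k \<Longrightarrow> k < x T + z \<Longrightarrow> v \<in> verts T \<Longrightarrow>
        sat G' (\<sigma>(y := (T, k, v))) \<psi> \<longleftrightarrow> sat G' (\<sigma>(y := (T, k0, v))) \<psi>"
      using swap[of \<psi> y \<sigma>, OF FAll.prems(1)] FAll.prems(2) unfolding free_vars.simps qdepth.simps by blast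
    have "\<exists>b\<in>verts G. sat G' (\<sigma>(y := a)) \<psi> \<longleftrightarrow> sat G (\<sigma>(y := b)) \<psi>" if a: "a \<in> verts G'" for a
    proof (cases "a \<in> verts G")
      case True
      show ?thesis
      proof (rule bexI)
        show "sat G' (\<sigma>(y := a)) \<psi> \<longleftrightarrow> sat G (\<sigma>(y := a)) \<psi>"
          by (rule sym[OF bspec[OF old True]])
      qed (rule True)
    next
      case False
      then obtain k v where a': "a = (T, k, v)" "x T \<le> k" "k < x T + z" "v \<in> verts T"
        using new a by blast
      have m: "(T, k0, v) \<in> verts G" using k0(1) a'(4) by (simp add: G verts_copies)
      show ?thesis unfolding a'(1)
      proof (rule bexI)
        show "sat G' (\<sigma>(y := (T, k, v))) \<psi> \<longleftrightarrow> sat G (\<sigma>(y := (T, k0, v))) \<psi>"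
          by (rule trans[OF k0(2)[OF a'(2-4)] sym[OF bspec[OF old m]]])
      qed (rule m)
    qed
    then show ?case unfolding sat.simps by (rule ball_bex_transfer(2)[OF sub old])
  next
    case (FModEx j l y \<psi>)
    have md: "modulus \<psi> dvd z" "l dvd z"
      using FModEx.prems(3) by (auto intro: dvd_mult_left dvd_mult_right)
    have old: "\<forall>a\<in>verts G. sat G (\<sigma>(y := a)) \<psi> \<longleftrightarrow> sat G' (\<sigma>(y := a)) \<psi>"
    proof
      fix a assume a: "a \<in> verts G"
      show "sat G (\<sigma>(y := a)) \<psi> \<longleftrightarrow> sat G' (\<sigma>(y := a)) \<psi>"
      proof (rule FModEx.IH)
        show "qdepth \<psi> \<le> card (untouched x T (free_vars \<psi>) (\<sigma>(y := a)))"
          using FModEx.prems(2) card_untouched_upd[of x T "free_vars \<psi>" y \<sigma> a] by simp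
      qed (use a FModEx.prems md in auto)
    qed
    obtain k0 where k0: "k0 < x T" "\<And>k v. x T \<le> k \<Longrightarrow> k < x T + z \<Longrightarrow> v \<in> verts T \<Longrightarrow>
        sat G' (\<sigma>(y := (T, k, v))) \<psi> \<longleftrightarrow> sat G' (\<sigma>(y := (T, k0, v))) \<psi>"
      using swap[of \<psi> y \<sigma>, OF FModEx.prems(1)] FModEx.prems(2) unfolding free_vars.simps qdepth.simps by blast
    let ?A = "{a \<in> verts G. sat G (\<sigma>(y := a)) \<psi>}"
    let ?B = "{v \<in> verts T. sat G' (\<sigma>(y := (T, k0, v))) \<psi>}"
    let ?N = "(\<lambda>(k, v). (T, k, v)) ` ({x T..<x T + z} \<times> ?B)"
    have eq: "{a \<in> verts G'. sat G' (\<sigma>(y := a)) \<psi>} = ?A \<union> ?N"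
    proof (intro set_eqI iffI)
      fix a assume a: "a \<in> {a \<in> verts G'. sat G' (\<sigma>(y := a)) \<psi>}"
      show "a \<in> ?A \<union> ?N"
      proof (cases "a \<in> verts G")
        case False
        then obtain k v where "a = (T, k, v)" "x T \<le> k" "k < x T + z" "v \<in> verts T"
          using new a by blast
        then show ?thesis using k0(2) a by auto
      qed (use a old in auto)
    next
      fix a assume "a \<in> ?A \<union> ?N"
      then show "a \<in> {a \<in> verts G'. sat G' (\<sigma>(y := a)) \<psi>}"
        using old sub k0(2) by (auto simp: G' verts_copies)
    qed
    have "card ?N = z * card ?B"
      by (subst card_image) (auto simp: inj_on_def card_cartesian_product)
    moreover have "?A \<inter> ?N = {}" by (auto simp: G verts_copies)
    moreover have "finite ?A" "finite ?N" using finx fin by (simp_all add: G)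
    ultimately have "card {a \<in> verts G'. sat G' (\<sigma>(y := a)) \<psi>} = card ?A + z * card ?B"
      unfolding eq by (simp only: card_Un_disjoint)
    moreover have "(card ?A + z * card ?B) mod l = card ?A mod l"
      by (rule mod_add_dvd) (rule dvd_mult2[OF md(2)])
    ultimately show ?case unfolding sat.simps by simp
  }
qed

definition count_equiv :: "nat \<Rightarrow> nat \<Rightarrow> nat \<Rightarrow> nat \<Rightarrow> bool" where
  "count_equiv t M a b \<longleftrightarrow> a = b \<or> (t \<le> a \<and> t \<le> b \<and> a mod M = b mod M)"

lemma finite_verts_copies:
  assumes "finite \<T>" "\<And>T. T \<in> \<T> \<Longrightarrow> finite (verts T)" "\<And>T. T \<notin> \<T> \<Longrightarrow> x T = 0"
  shows "finite (verts (copies x))"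
proof (rule finite_subset)
  show "verts (copies x) \<subseteq> (SIGMA T:\<T>. {..<x T} \<times> verts T)"
  proof
    fix a assume "a \<in> verts (copies x)"
    then show "a \<in> (SIGMA T:\<T>. {..<x T} \<times> verts T)"
      using assms(3)[of "fst a"] by (cases a) (auto simp: verts_copies)
  qed
  show "finite (SIGMA T:\<T>. {..<x T} \<times> verts T)"
    using assms(1,2) by (intro finite_SigmaI) auto
qed

text \<open>A sentence has no free variables, so all \<open>x T\<close> copies are untouched and the
  count itself meets the threshold.\<close>

lemma models_upd_le:
  assumes "sentence \<phi>" "finite (verts T)" "finite (verts (copies x))"
    and "qdepth \<phi> \<le> x T" "x T \<le> b" "x T mod modulus \<phi> = b mod modulus \<phi>"
  shows "models (copies x) \<phi> \<longleftrightarrow> models (copies (x(T := b))) \<phi>"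
proof -
  have fv: "free_vars \<phi> = {}" using assms(1) by (simp add: sentence_def)
  have "sat (copies x) \<sigma> \<phi> \<longleftrightarrow> sat (copies (x(T := b))) \<sigma> \<phi>" for \<sigma>
  proof (rule sat_add_copies[OF assms(2)])
    show "modulus \<phi> dvd b - x T" using assms(5,6) by (metis mod_eq_dvd_iff_nat)
    show "qdepth \<phi> \<le> card (untouched x T (free_vars \<phi>) \<sigma>)"
      using assms(4) by (simp add: fv untouched_def)
    show "copies (x(T := b)) = copies (x(T := x T + (b - x T)))" using assms(5) by simp
  qed (use assms(3) fv in simp_all)
  then show ?thesis unfolding models_def by blast
qed

lemma models_upd:
  assumes "sentence \<phi>" "finite (verts T)" "finite (verts (copies x))"
    and "finite (verts (copies (x(T := b))))"
    and "count_equiv (qdepth \<phi>) (modulus \<phi>) (x T) b"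
  shows "models (copies x) \<phi> \<longleftrightarrow> models (copies (x(T := b))) \<phi>"
proof (cases "x T = b")
  case True
  then have "x(T := b) = x" by auto
  then show ?thesis by simp
next
  case False
  then have eq: "qdepth \<phi> \<le> x T" "qdepth \<phi> \<le> b" "x T mod modulus \<phi> = b mod modulus \<phi>"
    using assms(5) by (auto simp: count_equiv_def)
  show ?thesis
  proof (cases "x T \<le> b")
    case True
    then show ?thesis using models_upd_le[of \<phi> T x b] assms eq by simp
  next
    case False
    \<comment> \<open>A decrease is read backwards, as an increase from \<open>b\<close> to
      \<open>x T\<close>.\<close>
    have "models (copies (x(T := b))) \<phi> \<longleftrightarrow> models (copies ((x(T := b))(T := x T))) \<phi>"
      by (rule models_upd_le) (use assms eq False in simp_all)
    then show ?thesis by simp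
  qed
qed

text \<open>Types are changed one at a time; the induction runs through mixtures that follow
  \<open>y\<close> on \<open>S\<close> and \<open>x\<close> elsewhere.\<close>

lemma models_count_equiv:
  assumes "sentence \<phi>" "finite \<T>" "\<And>T. T \<in> \<T> \<Longrightarrow> finite (verts T)"
    and "\<And>T. T \<notin> \<T> \<Longrightarrow> x T = 0" "\<And>T. T \<notin> \<T> \<Longrightarrow> y T = 0"
    and "\<And>T. T \<in> \<T> \<Longrightarrow> count_equiv (qdepth \<phi>) (modulus \<phi>) (x T) (y T)"
  shows "models (copies x) \<phi> \<longleftrightarrow> models (copies y) \<phi>"
proof -
  have "models (copies x) \<phi> \<longleftrightarrow> models (copies (\<lambda>T. if T \<in> S then y T else x T)) \<phi>"
    if "finite S" "S \<subseteq> \<T>" for S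
    using that
  proof (induction S)
    case (insert T S)
    let ?x = "\<lambda>T. if T \<in> S then y T else x T"
    have "models (copies ?x) \<phi> \<longleftrightarrow> models (copies (?x(T := y T))) \<phi>"
    proof (rule models_upd)
      show "finite (verts (copies ?x))" "finite (verts (copies (?x(T := y T))))"
        by (rule finite_verts_copies[of \<T>]; use assms(2-5) insert.prems in auto)+
    qed (use insert assms(1,3,6) in auto)
    moreover have "?x(T := y T) = (\<lambda>U. if U \<in> insert T S then y U else x U)"
      by auto
    ultimately show ?case using insert by simp
  qed simp
  moreover have "(\<lambda>T. if T \<in> \<T> then y T else x T) = y" using assms by auto
  ultimately show ?thesis using assms(2) by (metis order_refl)
qed

section \<open>Component types\<close>

definition component :: "'a ugraph \<Rightarrow> 'a \<Rightarrow> 'a set" where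
  "component G v = {u. (adj G)\<^sup>*\<^sup>* v u}"

definition induced :: "'a ugraph \<Rightarrow> 'a set \<Rightarrow> 'a ugraph" where
  "induced G C = \<lparr>verts = C, edges = {e \<in> edges G. e \<subseteq> C}\<rparr>"

text \<open>A finite supply of representatives for all possible components. It may also contain
  disconnected graphs and several isomorphic ones; \<open>type_of\<close> picks one per isomorphism
  class.\<close>

definition small_graphs :: "nat \<Rightarrow> nat \<Rightarrow> nat ugraph set" where
  "small_graphs c d = {T. sgraph T \<and> (\<exists>s\<le>c. 0 < s \<and> verts T = {..<s}) \<and> (\<forall>v\<in>verts T. degree T v \<le> d)}"

definition type_of :: "nat \<Rightarrow> nat \<Rightarrow> 'a ugraph \<Rightarrow> nat ugraph" where
  "type_of c d H = (SOME T. T \<in> small_graphs c d \<and> graph_iso T H)"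

lemma adj_induced: "adj (induced G C) u v \<longleftrightarrow> adj G u v \<and> u \<in> C \<and> v \<in> C"
  by (auto simp: adj_def induced_def)

lemma verts_induced [simp]: "verts (induced G C) = C"
  by (simp add: induced_def)

lemma graph_components_eq: "graph_components G = component G ` verts G"
  by (auto simp: graph_components_def component_def)

lemma component_refl: "v \<in> component G v"
  by (simp add: component_def)

lemma component_eq:
  assumes "u \<in> component G v"
  shows "component G u = component G v"
proof -
  have "symp (adj G)\<^sup>*\<^sup>*" by (rule symp_rtranclp) (metis adj_commute sympI)
  then have "(adj G)\<^sup>*\<^sup>* u v" using assms by (auto simp: component_def dest: sympD)
  then show ?thesis using assms by (auto simp: component_def)
qed

lemma component_adj: "adj G u v \<Longrightarrow> component G u = component G v"
  by (metis component_eq r_into_rtranclp mem_Collect_eq component_def)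

lemma sgraph_adj: "sgraph G \<Longrightarrow> adj G u v \<Longrightarrow> u \<in> verts G \<and> v \<in> verts G \<and> u \<noteq> v"
  by (force simp: sgraph_def adj_def)

lemma component_subset:
  assumes "sgraph G" "v \<in> verts G"
  shows "component G v \<subseteq> verts G"
proof
  fix u assume "u \<in> component G v"
  then have "(adj G)\<^sup>*\<^sup>* v u" by (simp add: component_def)
  then show "u \<in> verts G"
    using assms by (induction) (auto dest: sgraph_adj)
qed

lemma finite_neighbours: "sgraph G \<Longrightarrow> finite (neighbours G v)"
  using sgraph_adj[of G v] by (intro finite_subset[of "neighbours G v" "verts G"])
    (auto simp: neighbours_def sgraph_def)

text \<open>Isomorphic graphs have the same candidates, so the choice operator returns the same one:
  types can be compared by equality.\<close>

lemma type_of_cong: "graph_iso H K \<Longrightarrow> type_of c d H = type_of c d K"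
proof -
  assume "graph_iso H K"
  then have "graph_iso T H \<longleftrightarrow> graph_iso T K" for T :: "nat ugraph"
    using graph_iso_trans graph_iso_sym by metis
  then show ?thesis by (simp add: type_of_def)
qed

lemma finite_small_graphs: "finite (small_graphs c d)"
proof (rule finite_subset)
  show "small_graphs c d \<subseteq> (\<lambda>(V, E). \<lparr>verts = V, edges = E\<rparr>) ` (Pow {..<c} \<times> Pow (Pow {..<c}))"
  proof
    fix T assume T: "T \<in> small_graphs c d"
    have "verts T \<subseteq> {..<c}" using T by (auto simp: small_graphs_def)
    moreover have "edges T \<subseteq> Pow (verts T)" using T by (auto simp: small_graphs_def sgraph_def)
    ultimately have "(verts T, edges T) \<in> Pow {..<c} \<times> Pow (Pow {..<c})" by auto
    then show "T \<in> (\<lambda>(V, E). \<lparr>verts = V, edges = E\<rparr>) ` (Pow {..<c} \<times> Pow (Pow {..<c}))"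
      by (rule rev_image_eqI) simp
  qed
qed simp

lemma small_graphsD:
  assumes "T \<in> small_graphs c d"
  shows "sgraph T" "finite (verts T)" "0 < card (verts T)" "card (verts T) \<le> c"
    "\<And>v. v \<in> verts T \<Longrightarrow> degree T v \<le> d"
  using assms by (auto simp: small_graphs_def)

lemma bounded_component_graphsD:
  assumes "G \<in> bounded_component_graphs c d"
  shows "sgraph G" "finite (verts G)" "\<And>v. v \<in> verts G \<Longrightarrow> degree G v \<le> d"
    "\<And>v. v \<in> verts G \<Longrightarrow> card (component G v) \<le> c"
    "\<And>v. v \<in> verts G \<Longrightarrow> finite (component G v)"
proof -
  show G: "sgraph G" and fin: "finite (verts G)"
    using assms by (auto simp: bounded_component_graphs_def sgraph_def)
  show "degree G v \<le> d" "card (component G v) \<le> c" "finite (component G v)" if "v \<in> verts G" for v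
    using assms that finite_subset[OF component_subset[OF G that] fin]
    by (auto simp: bounded_component_graphs_def graph_components_eq)
qed

text \<open>Numbering the component by \<open>{..<s}\<close> and pulling its adjacency back gives a
  candidate, so the choice in \<open>type_of\<close> succeeds.\<close>

lemma type_of_spec:
  assumes G: "G \<in> bounded_component_graphs c d" and v: "v \<in> verts G"
  shows "type_of c d (induced G (component G v)) \<in> small_graphs c d \<and>
    graph_iso (type_of c d (induced G (component G v))) (induced G (component G v))"
proof -
  note GD = bounded_component_graphsD[OF G]
  let ?C = "component G v"
  define s where "s = card ?C"
  obtain h where h: "bij_betw h {..<s} ?C"
    using ex_bij_betw_nat_finite[OF GD(5)[OF v]] by (auto simp: s_def atLeast0LessThan)
  define T where "T = \<lparr>verts = {..<s}, edges = {{a, b} | a b. a < s \<and> b < s \<and> adj G (h a) (h b)}\<rparr>"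
  have hC: "h a \<in> ?C" "h a \<in> verts G" if "a < s" for a
    using bij_betwE[OF h] that component_subset[OF GD(1) v] by auto
  have adjT: "adj T a b \<longleftrightarrow> a < s \<and> b < s \<and> adj G (h a) (h b)" for a b
    by (auto simp: adj_def T_def doubleton_eq_iff insert_commute)
  have "sgraph T"
    unfolding sgraph_def
  proof (intro conjI ballI)
    fix e assume "e \<in> edges T"
    then obtain a b where e: "e = {a, b}" "a < s" "b < s" "adj G (h a) (h b)"
      by (auto simp: T_def)
    then have "a \<noteq> b" using sgraph_adj[OF GD(1)] by blast
    then show "e \<subseteq> verts T" "card e = 2" using e by (auto simp: T_def)
  qed (simp add: T_def)
  moreover have "0 < s" using GD(5)[OF v] component_refl[of v G] by (auto simp: s_def card_gt_0_iff)
  moreover have "s \<le> c" using GD(4)[OF v] by (simp add: s_def)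
  moreover have "degree T a \<le> d" if "a \<in> verts T" for a
  proof -
    have a: "a < s" using that by (simp add: T_def)
    have "inj_on h (neighbours T a)"
      using h by (auto simp: bij_betw_def neighbours_def adjT inj_on_def)
    moreover have "h ` neighbours T a \<subseteq> neighbours G (h a)"
      by (auto simp: neighbours_def adjT)
    ultimately have "degree T a \<le> degree G (h a)"
      unfolding degree_def using card_inj_on_le finite_neighbours[OF GD(1)] by blast
    then show ?thesis using GD(3)[OF hC(2)[OF a]] by simp
  qed
  ultimately have "T \<in> small_graphs c d" by (auto simp: small_graphs_def T_def)
  moreover have "is_iso h T (induced G ?C)"
    using h hC by (simp add: is_iso_def adjT adj_induced) (simp add: T_def)
  ultimately show ?thesis
    unfolding type_of_def using graph_iso_iff by (intro someI_ex[of "\<lambda>T. T \<in> small_graphs c d \<and> graph_iso T (induced G ?C)"]) blast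
qed

text \<open>\<open>x T\<close> is the number of components of type \<open>T\<close>. The last
  conclusion ties the first coordinate of a vertex of \<open>copies x\<close> to the type of its
  image; it turns facts about sampled types into facts about \<open>x\<close>.\<close>

lemma decomposition:
  assumes G: "G \<in> bounded_component_graphs c d"
  obtains x f where "\<And>T. T \<notin> small_graphs c d \<Longrightarrow> x T = 0" "is_iso f (copies x) G"
    "\<And>T k v. (T, k, v) \<in> verts (copies x) \<Longrightarrow>
       type_of c d (induced G (component G (f (T, k, v)))) = T"
proof -
  note GD = bounded_component_graphsD[OF G]
  define tp where "tp C = type_of c d (induced G C)" for C
  define S where "S T = {C \<in> graph_components G. tp C = T}" for T
  define x where "x T = card (S T)" for T
  have tp: "tp C \<in> small_graphs c d" "\<exists>h. is_iso h (tp C) (induced G C)"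
    if "C \<in> graph_components G" for C
    using that type_of_spec[OF G] by (auto simp: tp_def graph_components_eq graph_iso_iff)
  have comp: "component G w = C" if "C \<in> graph_components G" "w \<in> C" for w C
    using that by (auto simp: graph_components_eq dest: component_eq)
  have subG: "C \<subseteq> verts G" if "C \<in> graph_components G" for C
    using that component_subset[OF GD(1)] by (auto simp: graph_components_eq)
  have finS: "finite (S T)" for T
    using GD(2) by (simp add: S_def graph_components_eq)
  have "\<exists>e. bij_betw e {..<x T} (S T)" for T
    using ex_bij_betw_nat_finite[OF finS[of T]] by (auto simp: x_def atLeast0LessThan)
  then obtain en where en: "\<And>T. bij_betw (en T) {..<x T} (S T)" by metis
  obtain h where h: "\<And>C. C \<in> graph_components G \<Longrightarrow> is_iso (h C) (tp C) (induced G C)"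
    using tp(2) by metis
  define f where "f = (\<lambda>(T, k, v). h (en T k) v)"
  have enS: "en T k \<in> graph_components G" "tp (en T k) = T" if "k < x T" for T k
    using bij_betwE[OF en[of T]] that by (auto simp: S_def)
  have fC: "f (T, k, v) \<in> en T k" "component G (f (T, k, v)) = en T k" "f (T, k, v) \<in> verts G"
    if "k < x T" "v \<in> verts T" for T k v
  proof -
    show *: "f (T, k, v) \<in> en T k"
      using is_iso_mem[OF h[OF enS(1)[OF that(1)]]] that enS by (simp add: f_def)
    show "component G (f (T, k, v)) = en T k" "f (T, k, v) \<in> verts G"
      using comp[OF enS(1)[OF that(1)] *] subG[OF enS(1)[OF that(1)]] * by auto
  qed
  have same: "T = T' \<and> k = k'"
    if "en T k = en T' k'" "k < x T" "k' < x T'" for T k T' k'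
  proof -
    have "T = T'" using enS(2) that by metis
    then show ?thesis using that en[of T] by (auto simp: bij_betw_def inj_on_def)
  qed
  have "bij_betw f (verts (copies x)) (verts G)"
    unfolding bij_betw_def
  proof
    show "inj_on f (verts (copies x))"
    proof (rule inj_onI)
      fix a b assume ab: "a \<in> verts (copies x)" "b \<in> verts (copies x)" "f a = f b"
      obtain T k v where a: "a = (T, k, v)" by (cases a)
      obtain T' k' v' where b: "b = (T', k', v')" by (cases b)
      have l: "k < x T" "v \<in> verts T" "k' < x T'" "v' \<in> verts T'"
        using ab a b by (auto simp: verts_copies)
      have "en T k = en T' k'" using fC(2)[OF l(1,2)] fC(2)[OF l(3,4)] ab(3) a b by simp
      then have eq: "T = T'" "k = k'" using same l by auto
      have "inj_on (h (en T k)) (verts T)"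
        using h[OF enS(1)[OF l(1)]] enS(2)[OF l(1)] by (simp add: is_iso_def bij_betw_def)
      then show "a = b" using ab(3) l a b eq by (auto simp: f_def inj_on_def)
    qed
    show "f ` verts (copies x) = verts G"
    proof
      show "f ` verts (copies x) \<subseteq> verts G"
      proof
        fix w assume "w \<in> f ` verts (copies x)"
        then obtain T k v where "(T, k, v) \<in> verts (copies x)" "w = f (T, k, v)" by auto
        then show "w \<in> verts G" using fC(3)[of k T v] by (simp add: verts_copies)
      qed
      show "verts G \<subseteq> f ` verts (copies x)"
      proof
        fix w assume w: "w \<in> verts G"
        let ?C = "component G w" and ?T = "tp (component G w)"
        have C: "?C \<in> graph_components G" using w by (simp add: graph_components_eq)
        then have "?C \<in> S ?T" by (simp add: S_def)
        then obtain k where k: "k < x ?T" "en ?T k = ?C"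
          using en[of ?T] unfolding bij_betw_def by (metis imageE lessThan_iff)
        have "w \<in> h ?C ` verts ?T"
          using h[OF C] component_refl[of w G] by (auto simp: is_iso_def bij_betw_def)
        then obtain v where "v \<in> verts ?T" "w = h ?C v" by auto
        then show "w \<in> f ` verts (copies x)"
          using k by (intro image_eqI[of _ _ "(?T, k, v)"]) (auto simp: f_def verts_copies)
      qed
    qed
  qed
  moreover have "adj (copies x) a b \<longleftrightarrow> adj G (f a) (f b)"
    if ab: "a \<in> verts (copies x)" "b \<in> verts (copies x)" for a b
  proof -
    obtain T k v where a: "a = (T, k, v)" by (cases a)
    obtain T' k' v' where b: "b = (T', k', v')" by (cases b)
    have l: "k < x T" "v \<in> verts T" "k' < x T'" "v' \<in> verts T'"
      using ab a b by (auto simp: verts_copies)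
    show ?thesis
    proof (cases "T = T' \<and> k = k'")
      case True
      have "adj T v v' \<longleftrightarrow> adj (induced G (en T k)) (h (en T k) v) (h (en T k) v')"
        using is_iso_adj[OF h[OF enS(1)[OF l(1)]]] enS(2)[OF l(1)] l True by auto
      also have "\<dots> \<longleftrightarrow> adj G (f a) (f b)"
        using fC(1)[OF l(1,2)] fC(1)[OF l(3,4)] True by (simp add: adj_induced a b f_def)
      finally show ?thesis using True l by (simp add: a b adj_copies)
    next
      case False
      then have "en T k \<noteq> en T' k'" using same l by auto
      then have "\<not> adj G (f a) (f b)"
        using component_adj fC(2)[OF l(1,2)] fC(2)[OF l(3,4)] a b by metis
      then show ?thesis using False by (auto simp: a b adj_copies)
    qed
  qed
  ultimately have "is_iso f (copies x) G" by (simp add: is_iso_def)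
  moreover have "type_of c d (induced G (component G (f (T, k, v)))) = T"
    if "(T, k, v) \<in> verts (copies x)" for T k v
    using fC(2)[of k T v] enS(2)[of k T] that by (simp add: tp_def verts_copies)
  moreover have "x T = 0" if "T \<notin> small_graphs c d" for T
  proof -
    have "S T = {}" using tp(1) that by (auto simp: S_def)
    then show ?thesis by (simp add: x_def)
  qed
  ultimately show thesis using that by blast
qed

section \<open>Rewiring\<close>

lemma sgraph_edge_obtain:
  assumes "sgraph G" "e \<in> edges G"
  obtains u v where "e = {u, v}" "u \<in> verts G" "v \<in> verts G" "adj G u v"
proof -
  have "card e = 2" "e \<subseteq> verts G" using assms by (auto simp: sgraph_def)
  then obtain u v where "e = {u, v}" "u \<noteq> v" by (auto simp: card_2_iff)
  then show thesis using that assms(2) \<open>e \<subseteq> verts G\<close> by (auto simp: adj_def)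
qed

lemma is_iso_edges:
  assumes "is_iso f G H" "sgraph G" "sgraph H"
  shows "edges H = (`) f ` edges G"
proof (intro equalityI subsetI)
  fix e assume "e \<in> edges H"
  then obtain u v where e: "e = {u, v}" "u \<in> verts H" "v \<in> verts H" "adj H u v"
    using sgraph_edge_obtain[OF assms(3)] by blast
  moreover have "verts H = f ` verts G" using assms(1) by (simp add: is_iso_def bij_betw_def)
  ultimately obtain a b where ab: "a \<in> verts G" "b \<in> verts G" "u = f a" "v = f b" by auto
  then have "adj G a b" using is_iso_adj[OF assms(1)] e by simp
  then show "e \<in> (`) f ` edges G" using e ab by (auto simp: adj_def intro: image_eqI[of _ _ "{a, b}"])
next
  fix e assume "e \<in> (`) f ` edges G"
  then obtain e' where e': "e = f ` e'" "e' \<in> edges G" by auto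
  obtain u v where uv: "e' = {u, v}" "u \<in> verts G" "v \<in> verts G" "adj G u v"
    using sgraph_edge_obtain[OF assms(2) e'(2)] by blast
  then show "e \<in> edges H" using is_iso_adj[OF assms(1), of u v] e' by (simp add: adj_def)
qed

lemma image_graph:
  assumes "sgraph G" "inj_on f (verts G)"
  defines "F \<equiv> \<lparr>verts = f ` verts G, edges = (`) f ` edges G\<rparr>"
  shows "sgraph F" "is_iso f G F"
proof -
  show "sgraph F"
    unfolding sgraph_def
  proof (intro conjI ballI)
    show "finite (verts F)" using assms(1) by (simp add: F_def sgraph_def)
    fix e assume "e \<in> edges F"
    then obtain e' where e': "e = f ` e'" "e' \<in> edges G" by (auto simp: F_def)
    then have "e' \<subseteq> verts G" "card e' = 2" using assms(1) by (auto simp: sgraph_def)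
    then show "e \<subseteq> verts F" "card e = 2"
      using e' card_image[OF inj_on_subset[OF assms(2)]] by (auto simp: F_def)
  qed
  have "adj F (f u) (f v) \<longleftrightarrow> adj G u v" if uv: "u \<in> verts G" "v \<in> verts G" for u v
  proof
    assume "adj F (f u) (f v)"
    then obtain e where e: "e \<in> edges G" "f ` {u, v} = f ` e" by (auto simp: adj_def F_def)
    moreover have "e \<subseteq> verts G" using e(1) assms(1) by (auto simp: sgraph_def)
    ultimately have "{u, v} = e" using inj_on_image_eq_iff[OF assms(2), of "{u, v}" e] uv by blast
    then show "adj G u v" using e by (simp add: adj_def)
  qed (auto simp: adj_def F_def intro: rev_image_eqI)
  then show "is_iso f G F"
    using assms(2) by (auto simp: is_iso_def F_def bij_betw_def)
qed

lemma finite_edges: "sgraph G \<Longrightarrow> finite (edges G)"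
  by (rule finite_subset[of _ "Pow (verts G)"]) (auto simp: sgraph_def)

lemma card_edges_le:
  assumes "sgraph G" "\<And>v. v \<in> verts G \<Longrightarrow> degree G v \<le> d"
  shows "card (edges G) \<le> d * card (verts G)"
proof -
  have fin: "finite (verts G)" using assms(1) by (simp add: sgraph_def)
  have "edges G \<subseteq> (\<Union>v\<in>verts G. (\<lambda>u. {v, u}) ` neighbours G v)"
  proof
    fix e assume "e \<in> edges G"
    then obtain u v where "e = {u, v}" "u \<in> verts G" "v \<in> verts G" "adj G u v"
      using sgraph_edge_obtain[OF assms(1)] by blast
    then show "e \<in> (\<Union>v\<in>verts G. (\<lambda>u. {v, u}) ` neighbours G v)"
      by (auto simp: neighbours_def)
  qed
  then have "card (edges G) \<le> card (\<Union>v\<in>verts G. (\<lambda>u. {v, u}) ` neighbours G v)"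
    by (rule card_mono[rotated]) (use fin finite_neighbours[OF assms(1)] in auto)
  also have "\<dots> \<le> (\<Sum>v\<in>verts G. card ((\<lambda>u. {v, u}) ` neighbours G v))"
    by (rule card_UN_le[OF fin])
  also have "\<dots> \<le> (\<Sum>v\<in>verts G. d)"
    by (intro sum_mono order_trans[OF card_image_le[OF finite_neighbours[OF assms(1)]]])
      (use assms(2) in \<open>simp add: degree_def\<close>)
  finally show ?thesis by (simp add: mult.commute)
qed

definition supported :: "nat \<Rightarrow> nat \<Rightarrow> (nat ugraph \<Rightarrow> nat) \<Rightarrow> bool" where
  "supported c d x \<longleftrightarrow> (\<forall>T. T \<notin> small_graphs c d \<longrightarrow> x T = 0)"

definition total_size :: "nat \<Rightarrow> nat \<Rightarrow> (nat ugraph \<Rightarrow> nat) \<Rightarrow> nat" where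
  "total_size c d x = (\<Sum>T\<in>small_graphs c d. x T * card (verts T))"

lemma sgraph_copies:
  assumes "supported c d x"
  shows "sgraph (copies x)"
  unfolding sgraph_def
proof (intro conjI ballI)
  show "finite (verts (copies x))"
    by (rule finite_verts_copies[OF finite_small_graphs[of c d]])
      (use assms small_graphsD in \<open>auto simp: supported_def\<close>)
  fix e assume "e \<in> edges (copies x)"
  then obtain T k u v where e: "e = {(T, k, u), (T, k, v)}" "k < x T" "{u, v} \<in> edges T"
    by (auto simp: copies_def)
  then have "T \<in> small_graphs c d" using assms by (metis supported_def not_less0)
  then have "adj T u v \<and> sgraph T" using e small_graphsD by (simp add: adj_def)
  then have "u \<in> verts T" "v \<in> verts T" "u \<noteq> v" using sgraph_adj[of T u v] by auto
  then show "e \<subseteq> verts (copies x)" "card e = 2" using e by (auto simp: copies_def)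
qed

lemma card_verts_copies:
  assumes "supported c d x"
  shows "card (verts (copies x)) = total_size c d x"
proof -
  have "verts (copies x) = (SIGMA T:small_graphs c d. {..<x T} \<times> verts T)"
  proof (intro set_eqI iffI)
    fix a assume a: "a \<in> verts (copies x)"
    obtain T k v where T: "a = (T, k, v)" by (cases a)
    then have "k < x T" "v \<in> verts T" using a by (auto simp: verts_copies)
    moreover then have "T \<in> small_graphs c d" using assms by (metis supported_def not_less0)
    ultimately show "a \<in> (SIGMA T:small_graphs c d. {..<x T} \<times> verts T)" using T by simp
  qed (auto simp: verts_copies)
  moreover have "card \<dots> = (\<Sum>T\<in>small_graphs c d. card ({..<x T} \<times> verts T))"
    by (rule card_SigmaI[OF finite_small_graphs]) (auto dest: small_graphsD)
  ultimately show ?thesis by (simp add: total_size_def card_cartesian_product)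
qed

text \<open>Copies numbered below \<open>x T\<close> contribute no new edges, so only those in
  \<open>x T..<y T\<close> count. Truncated subtraction gives 0 for a type that loses
  copies.\<close>

lemma card_edges_copies_diff:
  assumes "supported c d x" "supported c d y"
  shows "card (edges (copies y) - edges (copies x)) \<le>
    (\<Sum>T\<in>small_graphs c d. d * ((y T - x T) * card (verts T)))"
proof -
  let ?S = "small_graphs c d"
  let ?E = "\<lambda>T. \<Union>k\<in>{x T..<y T}. (`) (\<lambda>v. (T, k, v)) ` edges T"
  have fin: "finite (edges T)" if "T \<in> ?S" for T
    using small_graphsD(1)[OF that] by (rule finite_edges)
  have "edges (copies y) - edges (copies x) \<subseteq> (\<Union>T\<in>?S. ?E T)"
  proof
    fix e assume e: "e \<in> edges (copies y) - edges (copies x)"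
    then obtain T k u v where Tk: "e = {(T, k, u), (T, k, v)}" "k < y T" "{u, v} \<in> edges T"
      by (auto simp: copies_def)
    have "\<not> k < x T" using e Tk by (auto simp: copies_def)
    moreover have "T \<in> ?S" using Tk assms(2) by (metis supported_def not_less0)
    ultimately have "T \<in> ?S" "k \<in> {x T..<y T}" "e = (\<lambda>v. (T, k, v)) ` {u, v}" using Tk by auto
    then show "e \<in> (\<Union>T\<in>?S. ?E T)" using Tk(3) by blast
  qed
  then have "card (edges (copies y) - edges (copies x)) \<le> card (\<Union>T\<in>?S. ?E T)"
    by (rule card_mono[rotated]) (use fin finite_small_graphs in auto)
  also have "\<dots> \<le> (\<Sum>T\<in>?S. card (?E T))"
    by (rule card_UN_le[OF finite_small_graphs])
  also have "\<dots> \<le> (\<Sum>T\<in>?S. d * ((y T - x T) * card (verts T)))"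
  proof (rule sum_mono)
    fix T assume T: "T \<in> ?S"
    have "card (?E T) \<le> (\<Sum>k\<in>{x T..<y T}. card ((`) (\<lambda>v. (T, k, v)) ` edges T))"
      by (rule card_UN_le) simp
    also have "\<dots> \<le> (\<Sum>k\<in>{x T..<y T}. d * card (verts T))"
      by (intro sum_mono order_trans[OF card_image_le[OF fin[OF T]]] card_edges_le)
        (use small_graphsD[OF T] in auto)
    finally show "card (?E T) \<le> d * ((y T - x T) * card (verts T))"
      by (simp add: mult.left_commute)
  qed
  finally show ?thesis .
qed

text \<open>No edge leaves a copy, so each component stays within a copy of some small graph,
  whether or not that graph is connected.\<close>

lemma iso_copies_bounded:
  assumes "supported c d y" "is_iso f (copies y) F" "sgraph F"
  shows "F \<in> bounded_component_graphs c d"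
proof -
  have inS: "T \<in> small_graphs c d" if "k < y T" for T k
    using that assms(1) by (metis supported_def not_less0)
  have im: "verts F = f ` verts (copies y)" using assms(2) by (simp add: is_iso_def bij_betw_def)
  have *: "\<exists>v'. w = f (T, k, v') \<and> adj T v v'" if "k < y T" "v \<in> verts T" "adj F (f (T, k, v)) w" for T k v w
  proof -
    have "w \<in> verts F" using sgraph_adj[OF assms(3) that(3)] by simp
    then obtain S l u where u: "(S, l, u) \<in> verts (copies y)" "w = f (S, l, u)" using im by auto
    moreover have "(T, k, v) \<in> verts (copies y)" using that by (simp add: verts_copies)
    ultimately have "adj (copies y) (T, k, v) (S, l, u)"
      using is_iso_adj[OF assms(2)] that(3) by blast
    then show ?thesis using u by (auto simp: adj_copies)
  qed
  have "degree F w \<le> d \<and> card (component F w) \<le> c" if "w \<in> verts F" for w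
  proof
    obtain T k v where w: "w = f (T, k, v)" and kv: "k < y T" "v \<in> verts T"
      using \<open>w \<in> verts F\<close> im by (auto simp: copies_def)
    note TS = small_graphsD[OF inS[OF kv(1)]]
    have "neighbours F w \<subseteq> (\<lambda>v'. f (T, k, v')) ` neighbours T v"
      using *[OF kv] w by (auto simp: neighbours_def)
    then have "degree F w \<le> degree T v"
      unfolding degree_def by (rule surj_card_le[OF finite_neighbours[OF TS(1)]])
    then show "degree F w \<le> d" using TS(5)[OF kv(2)] by simp
    have "\<exists>v'\<in>verts T. u = f (T, k, v')" if "(adj F)\<^sup>*\<^sup>* w u" for u
      using that
    proof induction
      case (step a b)
      then obtain v1 where v1: "v1 \<in> verts T" "a = f (T, k, v1)" by auto
      then obtain v2 where "b = f (T, k, v2)" "adj T v1 v2" using *[OF kv(1) v1(1)] step by auto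
      then show ?case using sgraph_adj[OF TS(1)] by blast
    qed (use w kv in auto)
    then have "component F w \<subseteq> (\<lambda>v'. f (T, k, v')) ` verts T"
      by (auto simp: component_def)
    then have "card (component F w) \<le> card (verts T)"
      by (rule surj_card_le[OF TS(2)])
    then show "card (component F w) \<le> c" using TS(4) by simp
  qed
  then show ?thesis
    using assms(3) by (auto simp: bounded_component_graphs_def graph_components_eq)
qed

text \<open>The copies present in both disjoint unions stay in place; only the others are rewired.\<close>

lemma rewire:
  assumes G: "sgraph G" and f: "is_iso f (copies x) G"
    and x: "supported c d x" and y: "supported c d y"
    and size: "total_size c d x = total_size c d y"
  obtains F \<phi> where "sgraph F" "verts F = verts G" "is_iso \<phi> (copies y) F"
    "edit_cost G F \<le> (\<Sum>T\<in>small_graphs c d. d * (((y T - x T) + (x T - y T)) * card (verts T)))"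
proof -
  let ?X = "copies x" and ?Y = "copies y"
  note sX = sgraph_copies[OF x] and sY = sgraph_copies[OF y]
  have fin: "finite (verts ?X)" "finite (verts ?Y)" using sX sY by (auto simp: sgraph_def)
  let ?V = "verts ?X \<inter> verts ?Y"
  \<comment> \<open>Vertices outside the shared copies can be matched arbitrarily, since all their
    edges are charged to the cost anyway.\<close>
  have "card (verts ?X - ?V) = card (verts ?Y - ?V)"
    using fin size card_verts_copies[OF x] card_verts_copies[OF y] by (simp add: card_Diff_subset)
  then obtain g where g: "bij_betw g (verts ?Y - ?V) (verts ?X - ?V)"
    using fin finite_same_card_bij[of "verts ?Y - ?V" "verts ?X - ?V"] by auto
  define h where "h a = (if a \<in> ?V then a else g a)" for a
  have "bij_betw h (?V \<union> (verts ?Y - ?V)) (?V \<union> (verts ?X - ?V))"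
  proof (rule bij_betw_combine)
    have "bij_betw id ?V ?V" by simp
    then show "bij_betw h ?V ?V" by (subst bij_betw_cong[of _ _ id]) (simp_all add: h_def)
    show "bij_betw h (verts ?Y - ?V) (verts ?X - ?V)"
      using g by (subst bij_betw_cong[of _ _ g]) (auto simp: h_def)
  qed auto
  moreover have "?V \<union> (verts ?Y - ?V) = verts ?Y" "?V \<union> (verts ?X - ?V) = verts ?X" by auto
  ultimately have h: "bij_betw h (verts ?Y) (verts ?X)" by simp
  define \<phi> where "\<phi> = f \<circ> h"
  have \<phi>: "bij_betw \<phi> (verts ?Y) (verts G)"
    unfolding \<phi>_def using f by (intro bij_betw_trans[OF h]) (simp add: is_iso_def)
  define F where "F = \<lparr>verts = \<phi> ` verts ?Y, edges = (`) \<phi> ` edges ?Y\<rparr>"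
  have F: "sgraph F" "is_iso \<phi> ?Y F" "verts F = verts G"
    using image_graph[OF sY, of \<phi>] \<phi> by (auto simp: F_def bij_betw_def)
  have eG: "edges G = (`) f ` edges ?X" by (rule is_iso_edges[OF f sX G])
  \<comment> \<open>An edge of both unions lies in \<open>?V\<close>, where \<open>h\<close> is the
    identity, and hence costs nothing.\<close>
  have common: "\<phi> ` e = f ` e" if "e \<in> edges ?X" "e \<in> edges ?Y" for e
  proof -
    have "e \<subseteq> ?V" using that sX sY by (auto simp: sgraph_def)
    then show ?thesis by (intro image_cong) (auto simp: \<phi>_def h_def)
  qed
  have "edges F - edges G \<subseteq> (`) \<phi> ` (edges ?Y - edges ?X)"
  proof
    fix e assume e: "e \<in> edges F - edges G"
    then obtain e' where "e' \<in> edges ?Y" "e = \<phi> ` e'" by (auto simp: F_def)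
    moreover have "e' \<notin> edges ?X"
    proof
      assume "e' \<in> edges ?X"
      then have "e \<in> edges G" using common[OF _ calculation(1)] calculation(2) by (auto simp: eG)
      then show False using e by simp
    qed
    ultimately show "e \<in> (`) \<phi> ` (edges ?Y - edges ?X)" by blast
  qed
  then have "card (edges F - edges G) \<le> card (edges ?Y - edges ?X)"
    by (rule surj_card_le[OF finite_Diff[OF finite_edges[OF sY]]])
  moreover have "edges G - edges F \<subseteq> (`) f ` (edges ?X - edges ?Y)"
  proof
    fix e assume e: "e \<in> edges G - edges F"
    then obtain e' where "e' \<in> edges ?X" "e = f ` e'" by (auto simp: eG)
    moreover have "e' \<notin> edges ?Y"
    proof
      assume "e' \<in> edges ?Y"
      then have "e = \<phi> ` e'" using common[OF calculation(1)] calculation(2) by simp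
      then have "e \<in> edges F" using \<open>e' \<in> edges ?Y\<close> by (simp add: F_def)
      then show False using e by simp
    qed
    ultimately show "e \<in> (`) f ` (edges ?X - edges ?Y)" by blast
  qed
  then have "card (edges G - edges F) \<le> card (edges ?X - edges ?Y)"
    by (rule surj_card_le[OF finite_Diff[OF finite_edges[OF sX]]])
  ultimately have "edit_cost G F \<le> card (edges ?Y - edges ?X) + card (edges ?X - edges ?Y)"
    by (simp add: edit_cost_def)
  also have "\<dots> \<le> (\<Sum>T\<in>small_graphs c d. d * ((y T - x T) * card (verts T))) +
      (\<Sum>T\<in>small_graphs c d. d * ((x T - y T) * card (verts T)))"
    by (intro add_mono card_edges_copies_diff x y)
  also have "\<dots> = (\<Sum>T\<in>small_graphs c d. d * (((y T - x T) + (x T - y T)) * card (verts T)))"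
    by (simp only: sum.distrib[symmetric] distrib_left distrib_right)
  finally show thesis using that F by blast
qed

lemma graph_dist_le: "sgraph F \<Longrightarrow> verts F = verts G \<Longrightarrow> graph_dist G F \<le> edit_cost G F"
  unfolding graph_dist_def
  by (intro Least_le exI[of _ F] conjI) (auto simp: graph_iso_def intro: exI[of _ id])

section \<open>Adjusting the number of copies\<close>

text \<open>Meant for rare types, where an error of \<open>x\<close> is affordable. A count
  \<open>y\<close> below the threshold has to be kept; otherwise the least representative of its
  class is taken, which is below \<open>t + Q\<close>.\<close>

lemma adjust_count_far:
  assumes "0 < (Q::nat)"
  shows "\<exists>a. count_equiv t Q a y \<and> \<bar>int a - int x\<bar> \<le> int (x + t + Q)"
proof (cases "y < t")
  case True
  then show ?thesis by (intro exI[of _ y]) (auto simp: count_equiv_def)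
next
  case False
  have "(t + (y - t) mod Q) mod Q = y mod Q"
    using False by (metis mod_add_right_eq le_add_diff_inverse not_less)
  moreover have "(y - t) mod Q < Q" using assms by simp
  ultimately show ?thesis
    using False by (intro exI[of _ "t + (y - t) mod Q"]) (auto simp: count_equiv_def)
qed

text \<open>From the threshold on, the class is a progression with step \<open>Q\<close> starting at
  some \<open>b < t + Q\<close>. The last member up to \<open>x\<close> is taken, or
  \<open>b\<close> itself if \<open>x < b\<close>, where \<open>x - b\<close> is 0.\<close>

lemma adjust_count_near:
  assumes "0 < (Q::nat)" "t \<le> y"
  shows "\<exists>a. count_equiv t Q a y \<and> \<bar>int a - int x\<bar> \<le> int (t + Q)"
proof -
  define b where "b = t + (y - t) mod Q"
  have b: "b mod Q = y mod Q" "b \<le> t + Q" "t \<le> b"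
    using assms mod_less_divisor[of Q "y - t"]
    by (auto simp: b_def mod_add_right_eq intro: less_imp_le)
  define a where "a = b + Q * ((x - b) div Q)"
  have "count_equiv t Q a y" using b assms by (simp add: count_equiv_def a_def)
  moreover have "Q * ((x - b) div Q) \<le> x - b" "x - b < Q * ((x - b) div Q) + Q"
    using mod_less_divisor[OF assms(1), of "x - b"] minus_mod_eq_mult_div[of "x - b" Q]
    by linarith+
  then have "\<bar>int a - int x\<bar> \<le> int (t + Q)" using b unfolding a_def by linarith
  ultimately show ?thesis by blast
qed

text \<open>
  All counts except that of one frequent type \<open>j\<close> are adjusted modulo \<open>Q = M * fact c\<close>; the type \<open>j\<close>
  absorbs the remaining vertices. As its size divides \<open>fact c\<close>, its count is still correct modulo \<open>M\<close>.
\<close>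

lemma adjust_counts:
  fixes x y s :: "'a \<Rightarrow> nat"
  assumes fin: "finite S" and M: "0 < M" and Q: "Q = M * fact c"
    and s: "\<And>T. T \<in> S \<Longrightarrow> 0 < s T \<and> s T \<le> c"
    and sx: "(\<Sum>T\<in>S. x T * s T) = n" and sy: "(\<Sum>T\<in>S. y T * s T) mod Q = n mod Q"
    and A: "\<And>T. T \<in> S \<Longrightarrow> t \<le> y T \<or> x T * s T \<le> D"
    and B: "B = D + c * (t + Q)"
    and j: "j \<in> S" "t \<le> y j" "card S * B + c * t \<le> x j * s j"
  obtains z where "\<And>T. T \<in> S \<Longrightarrow> count_equiv t M (z T) (y T)" "(\<Sum>T\<in>S. z T * s T) = n"
    "(\<Sum>T\<in>S. \<bar>int (z T) - int (x T)\<bar> * int (s T)) \<le> int (2 * card S * B)"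
proof -
  have Qpos: "0 < Q" using M by (simp add: Q)
  \<comment> \<open>Counted in vertices, \<open>D\<close> pays for giving up a rare type and
    \<open>c * (t + Q)\<close> for rounding to the residue class.\<close>
  have "\<exists>a. count_equiv t Q a (y T) \<and> \<bar>int a - int (x T)\<bar> * int (s T) \<le> int B" if T: "T \<in> S" for T
  proof (cases "t \<le> y T")
    case True
    then obtain a where a: "count_equiv t Q a (y T)" "\<bar>int a - int (x T)\<bar> \<le> int (t + Q)"
      using adjust_count_near[OF Qpos] by blast
    have "\<bar>int a - int (x T)\<bar> * int (s T) \<le> int (t + Q) * int c"
      using a(2) s[OF T] by (intro mult_mono) auto
    then show ?thesis using a(1) by (intro exI[of _ a]) (simp add: B algebra_simps)
  next
    case False
    then have xs: "x T * s T \<le> D" using A[OF T] by auto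
    obtain a where a: "count_equiv t Q a (y T)" "\<bar>int a - int (x T)\<bar> \<le> int (x T + t + Q)"
      using adjust_count_far[OF Qpos] by blast
    have "\<bar>int a - int (x T)\<bar> * int (s T) \<le> int (x T + t + Q) * int (s T)"
      using a(2) by (intro mult_right_mono) auto
    also have "\<dots> = int (x T * s T) + int (t + Q) * int (s T)" by (simp add: algebra_simps)
    also have "\<dots> \<le> int D + int (t + Q) * int c"
      using xs s[OF T] by (intro add_mono mult_left_mono) (simp_all only: of_nat_le_iff of_nat_0_le_iff)
    finally show ?thesis using a(1) by (intro exI[of _ a]) (simp add: B algebra_simps)
  qed
  then obtain a where a: "\<And>T. T \<in> S \<Longrightarrow> count_equiv t Q (a T) (y T)"
    "\<And>T. T \<in> S \<Longrightarrow> \<bar>int (a T) - int (x T)\<bar> * int (s T) \<le> int B" by metis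
  let ?S = "S - {j}"
  define R where "R = (\<Sum>T\<in>?S. a T * s T)"
  have split: "(\<Sum>T\<in>S. h T) = h j + (\<Sum>T\<in>?S. h T)" for h :: "'a \<Rightarrow> nat"
    using sum.remove[OF fin j(1)] .
  have near: "(\<Sum>T\<in>?S. \<bar>int (a T) - int (x T)\<bar> * int (s T)) \<le> int (card S * B)"
  proof -
    have "(\<Sum>T\<in>?S. \<bar>int (a T) - int (x T)\<bar> * int (s T)) \<le> (\<Sum>T\<in>?S. int B)"
      by (rule sum_mono) (use a(2) in auto)
    also have "\<dots> \<le> int (card S * B)" using fin by (simp add: mult_right_mono card_Diff1_le)
    finally show ?thesis .
  qed
  have n: "int n = int (x j * s j) + (\<Sum>T\<in>?S. int (x T) * int (s T))"
    using split[of "\<lambda>T. x T * s T"] sx by simp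
  have "\<bar>(\<Sum>T\<in>?S. int (a T) * int (s T)) - (\<Sum>T\<in>?S. int (x T) * int (s T))\<bar> \<le>
      (\<Sum>T\<in>?S. \<bar>int (a T) * int (s T) - int (x T) * int (s T)\<bar>)"
    unfolding sum_subtractf[symmetric] by (rule sum_abs)
  also have "\<dots> = (\<Sum>T\<in>?S. \<bar>int (a T) - int (x T)\<bar> * int (s T))"
    by (simp add: left_diff_distrib[symmetric] abs_mult)
  finally have Rn: "\<bar>int R - (int n - int (x j * s j))\<bar> \<le> int (card S * B)"
    using near n by (simp add: R_def)
  \<comment> \<open>As \<open>j\<close> is frequent, the other types leave it at least
    \<open>c * t\<close> vertices. Since \<open>s j \<le> c\<close>, this reserve keeps its new
    count at \<open>t\<close> or more.\<close>
  then have "int R \<le> int n - int (c * t)" using j(3) by linarith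
  then have Rle: "R + c * t \<le> n" by linarith
  have "s j dvd fact c" using s[OF j(1)] by (intro dvd_fact) auto
  then obtain q where "fact c = s j * q" by (rule dvdE)
  then have q: "Q = M * q * s j" by (simp add: Q)
  have "(\<Sum>T\<in>?S. a T * s T) mod Q = (\<Sum>T\<in>?S. y T * s T) mod Q"
  proof (subst (1 2) mod_sum_eq[symmetric], rule arg_cong[where f = "\<lambda>v. v mod Q"], rule sum.cong[OF refl])
    fix T assume "T \<in> ?S"
    then have "a T mod Q = y T mod Q" using a(1)[of T] by (auto simp: count_equiv_def)
    then show "a T * s T mod Q = y T * s T mod Q" by (metis mod_mult_left_eq)
  qed
  then have "(y j * s j + R) mod Q = (y j * s j + (\<Sum>T\<in>?S. y T * s T)) mod Q"
    unfolding R_def by (metis mod_add_right_eq)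
  then have "(y j * s j + R) mod Q = n mod Q" using sy split[of "\<lambda>T. y T * s T"] by simp
  then have "int Q dvd int n - int (y j * s j + R)"
    by (metis mod_eq_dvd_iff of_nat_mod)
  then obtain k where k: "int n - int (y j * s j + R) = int Q * k" by auto
  \<comment> \<open>The \<open>n - R\<close> vertices left for \<open>j\<close> amount to
    \<open>y j * s j + Q * k\<close> with \<open>Q = M * q * s j\<close>; dividing by
    \<open>s j\<close> gives this count. It is formed in the integers because \<open>k\<close> may
    be negative.\<close>
  define zj where "zj = int (y j) + int M * int q * k"
  have zs: "zj * int (s j) = int n - int R"
    using k by (simp add: zj_def q algebra_simps)
  have "int t * int (s j) \<le> int c * int t" using s[OF j(1)] by (subst mult.commute, intro mult_right_mono) simp_all
  also have "\<dots> \<le> zj * int (s j)" using Rle unfolding zs by (metis of_nat_add of_nat_le_iff of_nat_mult le_diff_eq add.commute)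
  finally have "int t \<le> zj" using s[OF j(1)] by simp
  define z where "z T = (if T = j then nat zj else a T)" for T
  have zj: "int (z j) = zj" using \<open>int t \<le> zj\<close> by (simp add: z_def)
  have "int (z j) mod int M = int (y j) mod int M" by (simp add: zj zj_def mult.assoc)
  then have "z j mod M = y j mod M" by (metis of_nat_eq_iff of_nat_mod)
  then have "count_equiv t M (z j) (y j)"
    using \<open>int t \<le> zj\<close> zj j(2) unfolding count_equiv_def by linarith
  moreover have "count_equiv t M (a T) (y T)" if "T \<in> S" for T
    using a(1)[OF that] unfolding count_equiv_def Q by (metis mod_mult_right_eq mod_mod_cancel dvd_triv_left)
  ultimately have 1: "count_equiv t M (z T) (y T)" if "T \<in> S" for T
    using that by (cases "T = j") (auto simp: z_def)
  have zS: "(\<Sum>T\<in>?S. z T * s T) = R" unfolding R_def by (rule sum.cong) (auto simp: z_def)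
  have "int (\<Sum>T\<in>S. z T * s T) = int n"
    using split[of "\<lambda>T. z T * s T"] zs zj zS by simp
  then have 2: "(\<Sum>T\<in>S. z T * s T) = n" by linarith
  have "(\<Sum>T\<in>S. \<bar>int (z T) - int (x T)\<bar> * int (s T)) =
      \<bar>int (z j) - int (x j)\<bar> * int (s j) + (\<Sum>T\<in>?S. \<bar>int (z T) - int (x T)\<bar> * int (s T))"
    by (rule sum.remove[OF fin j(1)])
  also have "(\<Sum>T\<in>?S. \<bar>int (z T) - int (x T)\<bar> * int (s T)) = (\<Sum>T\<in>?S. \<bar>int (a T) - int (x T)\<bar> * int (s T))"
    by (rule sum.cong) (auto simp: z_def)
  also have "\<bar>int (z j) - int (x j)\<bar> * int (s j) = \<bar>zj * int (s j) - int (x j * s j)\<bar>"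
    by (simp add: zj left_diff_distrib[symmetric] abs_mult)
  also have "\<dots> \<le> int (card S * B)" using Rn unfolding zs by linarith
  finally have "(\<Sum>T\<in>S. \<bar>int (z T) - int (x T)\<bar> * int (s T)) \<le> int (2 * card S * B)"
    using near by simp
  with 1 2 show thesis using that by blast
qed

section \<open>The acceptance condition\<close>

text \<open>
  \<open>A\<close> is the set of component types seen in the sample. Only the residue of \<open>n\<close> is compared with
  the size of the witness, which keeps the condition decidable in constant time.
\<close>

definition admits :: "nat \<Rightarrow> nat \<Rightarrow> fo_mod \<Rightarrow> nat \<Rightarrow> nat ugraph set \<Rightarrow> bool" where
  "admits c d \<phi> n A \<longleftrightarrow> (\<exists>y. supported c d y \<and> models (copies y) \<phi> \<and>
     total_size c d y mod (modulus \<phi> * fact c) = n mod (modulus \<phi> * fact c) \<and>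
     (\<forall>T\<in>A. qdepth \<phi> \<le> y T))"

lemma admits_complete:
  assumes "sentence \<phi>" "G \<in> property_of \<phi>" "is_iso f (copies x) G" "supported c d x"
    and "total_size c d x = n" "\<And>T. T \<in> A \<Longrightarrow> qdepth \<phi> \<le> x T"
  shows "admits c d \<phi> n A"
proof -
  have "models G \<phi>" using assms(2) by (simp add: property_of_def models_def)
  then have "models (copies x) \<phi>" using models_iso[OF _ assms(1)] assms(3) graph_iso_iff by metis
  then show ?thesis using assms unfolding admits_def by blast
qed

text \<open>\<open>B\<close> bounds the change, in vertices, of each type but the absorbing one.
  \<open>l1\<close> makes the total change affordable; \<open>l2\<close> makes the largest type big
  enough to absorb the errors of the others.\<close>

lemma admits_close:
  assumes \<phi>: "sentence \<phi>" and G: "sgraph (G :: nat ugraph)" and f: "is_iso f (copies x) G"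
    and x: "supported c d x" and n: "total_size c d x = n" "0 < n"
    and adm: "admits c d \<phi> n A"
    and rare: "\<And>T. T \<in> small_graphs c d \<Longrightarrow> T \<notin> A \<Longrightarrow> x T * card (verts T) \<le> D"
    and B: "B = D + c * (qdepth \<phi> + modulus \<phi> * fact c)"
    and m: "m = card (small_graphs c d)"
    and l1: "real (2 * m * B) \<le> \<epsilon> * real n" and \<epsilon>: "\<epsilon> \<le> 1"
    and l2: "m * (m * B + c * qdepth \<phi>) \<le> n"
  shows "\<exists>H \<in> property_of \<phi> \<inter> bounded_component_graphs c d. eps_close \<epsilon> d G H"
proof -
  let ?S = "small_graphs c d" and ?s = "\<lambda>T. card (verts T)"
  note fin = finite_small_graphs[of c d]
  obtain y where y: "supported c d y" "models (copies y) \<phi>"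
     "total_size c d y mod (modulus \<phi> * fact c) = n mod (modulus \<phi> * fact c)"
     "\<And>T. T \<in> A \<Longrightarrow> qdepth \<phi> \<le> y T"
    using adm unfolding admits_def by blast
  have M: "0 < modulus \<phi>" using \<phi> by (auto simp: sentence_def intro: modulus_pos)
  have sz: "(\<Sum>T\<in>?S. x T * ?s T) = n" using n by (simp add: total_size_def)
  \<comment> \<open>Pigeonhole: the largest of the \<open>m\<close> types fills at least
    \<open>n / m\<close> vertices.\<close>
  have "\<exists>j\<in>?S. n \<le> m * (x j * ?s j)"
  proof (rule ccontr)
    assume "\<not> ?thesis"
    then have lt: "m * (x T * ?s T) < n" if "T \<in> ?S" for T using that by force
    have "?S \<noteq> {}" using sz n(2) by auto
    then have "(\<Sum>T\<in>?S. m * (x T * ?s T)) < (\<Sum>T\<in>?S. n)"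
      by (rule sum_strict_mono[OF fin]) (use lt in auto)
    then show False using sz by (simp add: sum_distrib_left[symmetric] m)
  qed
  then obtain j where j: "j \<in> ?S" "n \<le> m * (x j * ?s j)" by blast
  have mpos: "0 < m" using j(1) fin by (auto simp: m card_gt_0_iff)
  have "m * (m * B + c * qdepth \<phi>) \<le> m * (x j * ?s j)" using l2 j(2) by (rule order_trans)
  then have jl: "m * B + c * qdepth \<phi> \<le> x j * ?s j" using mpos by (simp only: mult_le_cancel1)
  \<comment> \<open>An unseen \<open>j\<close> would be rare, giving \<open>n \<le> m * B\<close>,
    while \<open>l1\<close> and \<open>\<epsilon> \<le> 1\<close> give
    \<open>2 * m * B \<le> n\<close>.\<close>
  have "j \<in> A"
  proof (rule ccontr)
    assume "j \<notin> A"
    then have "x j * ?s j \<le> B" using rare[OF j(1)] B by simp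
    then have "m * (x j * ?s j) \<le> m * B" by simp
    then have "n \<le> m * B" using j(2) by (rule order_trans[rotated])
    moreover have "real (2 * m * B) \<le> real n" using l1 mult_right_mono[OF \<epsilon>, of "real n"] by simp
    then have "2 * (m * B) \<le> n" unfolding of_nat_le_iff by simp
    ultimately show False using n(2) by linarith
  qed
  have yA: "qdepth \<phi> \<le> y T \<or> x T * ?s T \<le> D" if "T \<in> ?S" for T
    using rare[OF that] y(4)[of T] by blast
  have sT: "0 < ?s T \<and> ?s T \<le> c" if "T \<in> ?S" for T using small_graphsD[OF that] by auto
  obtain z' where z': "\<And>T. T \<in> ?S \<Longrightarrow> count_equiv (qdepth \<phi>) (modulus \<phi>) (z' T) (y T)"
    "(\<Sum>T\<in>?S. z' T * ?s T) = n"
    "(\<Sum>T\<in>?S. \<bar>int (z' T) - int (x T)\<bar> * int (?s T)) \<le> int (2 * card ?S * B)"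
    using adjust_counts[OF fin M refl sT sz y(3)[unfolded total_size_def] yA B j(1) y(4)[OF \<open>j \<in> A\<close>] jl[unfolded m]]
    by blast
  \<comment> \<open>The adjusted counts are known only on \<open>?S\<close>; the value 0 elsewhere
    makes \<open>z\<close> supported.\<close>
  define z where "z T = (if T \<in> ?S then z' T else 0)" for T
  have z: "supported c d z" by (simp add: supported_def z_def)
  have zsize: "total_size c d x = total_size c d z" using z'(2) n by (simp add: total_size_def z_def)
  obtain F \<psi> where F: "sgraph F" "verts F = verts G" "is_iso \<psi> (copies z) F"
    "edit_cost G F \<le> (\<Sum>T\<in>?S. d * (((z T - x T) + (x T - z T)) * ?s T))"
    using rewire[OF G f x z zsize] by blast
  have "models (copies z) \<phi> \<longleftrightarrow> models (copies y) \<phi>"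
    by (rule models_count_equiv[OF \<phi> fin])
      (use small_graphsD z y(1) z'(1) in \<open>auto simp: supported_def z_def\<close>)
  then have "models F \<phi>" using y(2) models_iso[OF _ \<phi>, of "copies z" F] F(3) graph_iso_iff by blast
  then have "F \<in> property_of \<phi>" using F(1) by (simp add: property_of_def models_def)
  moreover have "F \<in> bounded_component_graphs c d"
    by (rule iso_copies_bounded[OF z F(3) F(1)])
  moreover have "eps_close \<epsilon> d G F"
  proof -
    have "int (graph_dist G F) \<le> int (\<Sum>T\<in>?S. d * (((z T - x T) + (x T - z T)) * ?s T))"
      using graph_dist_le[OF F(1,2)] F(4) by linarith
    also have "\<dots> = (\<Sum>T\<in>?S. int d * (\<bar>int (z' T) - int (x T)\<bar> * int (?s T)))"
      unfolding of_nat_sum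
    proof (rule sum.cong[OF refl])
      fix T assume "T \<in> ?S"
      have "int ((a - b) + (b - a)) = \<bar>int a - int b\<bar>" for a b :: nat by linarith
      then show "int (d * (((z T - x T) + (x T - z T)) * ?s T)) = int d * (\<bar>int (z' T) - int (x T)\<bar> * int (?s T))"
        using \<open>T \<in> ?S\<close> by (simp only: of_nat_mult z_def if_True)
    qed
    also have "\<dots> \<le> int d * int (2 * card ?S * B)"
      unfolding sum_distrib_left[symmetric] using z'(3) by (rule mult_left_mono) simp
    finally have "graph_dist G F \<le> d * (2 * m * B)" unfolding m by (metis of_nat_le_iff of_nat_mult)
    \<comment> \<open>Each vertex of an added or removed copy costs at most \<open>d\<close> edges,
      and \<open>eps_close\<close> scales with \<open>d\<close> too; so \<open>l1\<close> is free of
      \<open>d\<close>.\<close>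
    then have "real (graph_dist G F) \<le> real d * real (2 * m * B)" by (metis of_nat_le_iff of_nat_mult)
    also have "\<dots> \<le> real d * (\<epsilon> * real n)" using l1 by (rule mult_left_mono) simp
    also have "n = card (verts G)"
      using card_verts_copies[OF x] n(1) f bij_betw_same_card by (auto simp: is_iso_def)
    finally show ?thesis by (simp add: eps_close_def F(2) algebra_simps)
  qed
  ultimately show ?thesis by blast
qed

section \<open>Programs deciding by equality patterns\<close>

text \<open>The program counter 0 is a dummy: how an instruction changes the registers does not
  depend on it.\<close>

definition effect :: "oracle_fun \<Rightarrow> instr \<Rightarrow> (nat \<Rightarrow> nat) \<Rightarrow> (nat \<Rightarrow> nat) pmf" where
  "effect orc i m = map_pmf snd (exec orc i (0, m))"

fun straight :: "instr \<Rightarrow> bool" where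
  "straight (Jump l) = False"
| "straight (JumpEq a b l) = False"
| "straight (JumpLess a b l) = False"
| "straight Accept = False"
| "straight Reject = False"
| "straight _ = True"

primrec effects :: "oracle_fun \<Rightarrow> instr list \<Rightarrow> (nat \<Rightarrow> nat) \<Rightarrow> (nat \<Rightarrow> nat) pmf" where
  "effects orc [] m = return_pmf m"
| "effects orc (i # is) m = bind_pmf (effect orc i m) (effects orc is)"

lemma exec_straight:
  "straight i \<Longrightarrow> exec orc i (pc, m) = map_pmf (\<lambda>m'. (Suc pc, m')) (effect orc i m)"
  by (cases i) (simp_all add: effect_def map_pmf_comp)

lemma effects_append: "effects orc (is @ js) m = bind_pmf (effects orc is m) (effects orc js)"
proof (induction "is" arbitrary: m)
  case (Cons i "is")
  then have "effects orc (is @ js) = (\<lambda>m. bind_pmf (effects orc is m) (effects orc js))" by blast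
  then show ?case by (simp add: bind_assoc_pmf)
qed (simp add: bind_return_pmf)

lemma run_add: "run orc p (a + b) s = bind_pmf (run orc p a s) (run orc p b)"
proof (induction a arbitrary: s)
  case (Suc a)
  then have "run orc p (a + b) = (\<lambda>s. bind_pmf (run orc p a s) (run orc p b))" by blast
  then show ?case by (simp add: bind_assoc_pmf)
qed (simp add: bind_return_pmf)

lemma run_straight:
  assumes "list_all straight is" "p = pre @ is @ post"
  shows "run orc p (length is) (length pre, m) =
    map_pmf (\<lambda>m'. (length pre + length is, m')) (effects orc is m)"
  using assms
proof (induction "is" arbitrary: pre m)
  case (Cons i "is")
  have "step orc p (length pre, m) = map_pmf (\<lambda>m'. (Suc (length pre), m')) (effect orc i m)"
    using Cons.prems by (simp add: step_def exec_straight nth_append)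
  moreover have "run orc p (length is) (Suc (length pre), m') =
      map_pmf (\<lambda>m'. (length pre + length (i # is), m')) (effects orc is m')" for m'
    using Cons.IH[of "pre @ [i]" m'] Cons.prems by simp
  ultimately show ?case by (simp add: bind_map_pmf map_bind_pmf)
qed simp

text \<open>
  \<open>code b t\<close> leaves the value of \<open>t\<close> in register \<open>b\<close> and uses the registers from \<open>b\<close> on as a stack.
\<close>

datatype query_term =
    Reg nat
  | Cnst nat
  | Rem query_term query_term
  | Ask query_term query_term

primrec regs :: "query_term \<Rightarrow> nat set" where
  "regs (Reg r) = {r}"
| "regs (Cnst k) = {}"
| "regs (Rem t u) = regs t \<union> regs u"
| "regs (Ask t u) = regs t \<union> regs u"

definition ask :: "oracle_fun \<Rightarrow> nat \<Rightarrow> nat \<Rightarrow> nat" where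
  "ask orc v i = (case orc v i of Some u \<Rightarrow> u | None \<Rightarrow> 0)"

primrec val :: "oracle_fun \<Rightarrow> (nat \<Rightarrow> nat) \<Rightarrow> query_term \<Rightarrow> nat" where
  "val orc m (Reg r) = m r"
| "val orc m (Cnst k) = k"
| "val orc m (Rem t u) = val orc m t mod val orc m u"
| "val orc m (Ask t u) = ask orc (val orc m t) (val orc m u)"

primrec code :: "nat \<Rightarrow> query_term \<Rightarrow> instr list" where
  "code b (Reg r) = [Copy b r]"
| "code b (Cnst k) = [Const b k]"
| "code b (Rem t u) = code b t @ code (Suc b) u @ [Mod b b (Suc b)]"
| "code b (Ask t u) = code b t @ code (Suc b) u @ [Query b b (Suc b)]"

primrec code_list :: "nat \<Rightarrow> query_term list \<Rightarrow> instr list" where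
  "code_list b [] = []"
| "code_list b (t # ts) = code b t @ code_list (Suc b) ts"

lemma val_cong: "(\<And>r. r \<in> regs t \<Longrightarrow> m r = m' r) \<Longrightarrow> val orc m t = val orc m' t"
  by (induction t) auto

lemma straight_code: "list_all straight (code b t)"
  by (induction t arbitrary: b) auto

lemma straight_code_list: "list_all straight (code_list b ts)"
  by (induction ts arbitrary: b) (auto simp: straight_code)

text \<open>Preserving the registers below \<open>b\<close> is the invariant that makes the stack
  work: the second operand, computed from \<open>Suc b\<close> on, overwrites neither the first
  operand nor the inputs.\<close>

lemma effects_code:
  assumes "regs t \<subseteq> {..<b}"
  shows "\<exists>m'. effects orc (code b t) m = return_pmf m' \<and> m' b = val orc m t \<and> (\<forall>r<b. m' r = m r)"
  using assms
proof (induction t arbitrary: b m)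
  case (Rem t u)
  obtain m1 where m1: "effects orc (code b t) m = return_pmf m1" "m1 b = val orc m t" "\<forall>r<b. m1 r = m r"
    using Rem.IH(1)[of b m] Rem.prems by auto
  obtain m2 where m2: "effects orc (code (Suc b) u) m1 = return_pmf m2" "m2 (Suc b) = val orc m1 u"
      "\<forall>r<Suc b. m2 r = m1 r"
    using Rem.IH(2)[of "Suc b" m1] Rem.prems subset_trans[of "regs u" "{..<b}" "{..<Suc b}"] by auto
  have "val orc m1 u = val orc m u"
    by (rule val_cong) (use m1(3) Rem.prems in auto)
  then show ?case
    using m1 m2 by (simp add: effects_append bind_return_pmf effect_def)
next
  case (Ask t u)
  obtain m1 where m1: "effects orc (code b t) m = return_pmf m1" "m1 b = val orc m t" "\<forall>r<b. m1 r = m r"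
    using Ask.IH(1)[of b m] Ask.prems by auto
  obtain m2 where m2: "effects orc (code (Suc b) u) m1 = return_pmf m2" "m2 (Suc b) = val orc m1 u"
      "\<forall>r<Suc b. m2 r = m1 r"
    using Ask.IH(2)[of "Suc b" m1] Ask.prems subset_trans[of "regs u" "{..<b}" "{..<Suc b}"] by auto
  have "val orc m1 u = val orc m u"
    by (rule val_cong) (use m1(3) Ask.prems in auto)
  then show ?case
    using m1 m2 by (simp add: effects_append bind_return_pmf effect_def ask_def)
qed (simp_all add: effect_def bind_return_pmf)

lemma effects_code_list:
  assumes "\<And>t. t \<in> set ts \<Longrightarrow> regs t \<subseteq> {..<b}"
  shows "\<exists>m'. effects orc (code_list b ts) m = return_pmf m' \<and>
    map m' [b..<b + length ts] = map (val orc m) ts \<and> (\<forall>r<b. m' r = m r)"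
  using assms
proof (induction ts arbitrary: b m)
  case (Cons t ts)
  obtain m1 where m1: "effects orc (code b t) m = return_pmf m1" "m1 b = val orc m t" "\<forall>r<b. m1 r = m r"
    using effects_code[of t b orc m] Cons.prems by auto
  have "regs u \<subseteq> {..<Suc b}" if "u \<in> set ts" for u using Cons.prems[of u] that by auto
  then obtain m2 where m2: "effects orc (code_list (Suc b) ts) m1 = return_pmf m2"
      "map m2 [Suc b..<Suc b + length ts] = map (val orc m1) ts" "\<forall>r<Suc b. m2 r = m1 r"
    using Cons.IH[of "Suc b" m1] by blast
  have "map (val orc m1) ts = map (val orc m) ts"
    using m1(3) Cons.prems by (intro map_cong val_cong) auto
  then have "map m2 [b..<b + length (t # ts)] = map (val orc m) (t # ts)"
    using m1 m2 by (simp add: upt_conv_Cons del: upt_Suc)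
  then show ?case using m1 m2 by (intro exI[of _ m2]) (simp add: effects_append bind_return_pmf)
qed simp

definition input_mem :: "nat \<Rightarrow> nat list \<Rightarrow> nat \<Rightarrow> nat" where
  "input_mem n \<omega> r = (if r \<le> length \<omega> then (n # \<omega>) ! r else 0)"

text \<open>\<open>0 < a\<close> protects register 0, from which every draw reads its range.\<close>

lemma effects_sample:
  assumes "0 < a"
  shows "effects orc (map (\<lambda>i. Sample i 0) [a..<a + k]) m =
    map_pmf (\<lambda>\<omega> r. if a \<le> r \<and> r < a + k then \<omega> ! (r - a) else m r) (replicate_pmf k (uniform_upto (m 0)))"
  using assms
proof (induction k arbitrary: a m)
  case (Suc k)
  have "map (\<lambda>i. Sample i 0) [a..<a + Suc k] = Sample a 0 # map (\<lambda>i. Sample i 0) [Suc a..<Suc a + k]"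
    by (simp add: upt_conv_Cons)
  moreover have "(\<lambda>r. if Suc a \<le> r \<and> r < Suc a + k then \<omega> ! (r - Suc a) else (m(a := x)) r) =
      (\<lambda>r. if a \<le> r \<and> r < a + Suc k then (x # \<omega>) ! (r - a) else m r)" for x \<omega>
    by (rule ext) (auto simp: Suc_diff_Suc nth_Cons' intro: arg_cong)
  moreover have "effect orc (Sample a 0) m = map_pmf (\<lambda>x. m(a := x)) (uniform_upto (m 0))"
    by (simp add: effect_def map_pmf_comp)
  moreover have "effects orc (map (\<lambda>i. Sample i 0) [Suc a..<Suc a + k]) (m(a := x)) =
      map_pmf (\<lambda>\<omega> r. if Suc a \<le> r \<and> r < Suc a + k then \<omega> ! (r - Suc a) else (m(a := x)) r)
        (replicate_pmf k (uniform_upto (m 0)))" for x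
  proof -
    have "(m(a := x)) 0 = m 0" using Suc.prems by simp
    then show ?thesis using Suc.IH[of "Suc a" "m(a := x)"] by (simp only: zero_less_Suc)
  qed
  ultimately show ?case
    by (simp only: effects.simps bind_map_pmf replicate_pmf.simps map_bind_pmf map_return_pmf)
      (simp only: map_pmf_def)
qed (simp add: fun_eq_iff)

section \<open>Decision trees over register equalities\<close>

datatype dtree = Leaf bool | Test nat nat dtree dtree

text \<open>Jump targets are absolute, hence the start address \<open>l\<close>. The branch for
  inequality follows the jump directly and never runs into the other branch, because every leaf
  halts.\<close>

primrec dcode :: "nat \<Rightarrow> dtree \<Rightarrow> instr list" where
  "dcode l (Leaf b) = [if b then Accept else Reject]"
| "dcode l (Test a b t u) = JumpEq a b (Suc l + length (dcode (Suc l) u)) # dcode (Suc l) u @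
     dcode (Suc l + length (dcode (Suc l) u)) t"

primrec decide :: "(nat \<Rightarrow> nat) \<Rightarrow> dtree \<Rightarrow> bool" where
  "decide m (Leaf b) = b"
| "decide m (Test a b t u) = (if m a = m b then decide m t else decide m u)"

primrec depth :: "dtree \<Rightarrow> nat" where
  "depth (Leaf b) = 0"
| "depth (Test a b t u) = Suc (max (depth t) (depth u))"

lemma run_halted:
  assumes "pc < length p" "p ! pc = Accept \<or> p ! pc = Reject"
  shows "run orc p k (pc, m) = return_pmf (pc, m)"
proof (induction k)
  case (Suc k)
  have "step orc p (pc, m) = return_pmf (pc, m)" using assms by (auto simp: step_def)
  then show ?case using Suc by (simp add: bind_return_pmf)
qed simp

text \<open>A machine that has reached a leaf stays there, so any \<open>k\<close> from the depth on
  will do and one time bound covers all branches.\<close>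

lemma run_dcode:
  assumes "p = pre @ dcode (length pre) t @ post" "depth t \<le> k"
  shows "\<exists>pc. pc < length p \<and> p ! pc = (if decide m t then Accept else Reject) \<and>
    run orc p k (length pre, m) = return_pmf (pc, m)"
  using assms
proof (induction t arbitrary: pre post k)
  case (Leaf b)
  then have l: "p ! length pre = (if b then Accept else Reject)" "length pre < length p" by simp_all
  then have "run orc p k (length pre, m) = return_pmf (length pre, m)"
    by (intro run_halted) simp_all
  then show ?case using l by (intro exI[of _ "length pre"]) simp
next
  case (Test a b t u)
  obtain k' where k: "k = Suc k'" "depth t \<le> k'" "depth u \<le> k'"
    using Test.prems(2) by (cases k) auto
  let ?lt = "Suc (length pre) + length (dcode (Suc (length pre)) u)"
  let ?j = "JumpEq a b ?lt"
  have "p ! length pre = ?j" "length pre < length p" using Test.prems(1) by simp_all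
  then have step: "step orc p (length pre, m) = return_pmf (if m a = m b then ?lt else Suc (length pre), m)"
    by (simp add: step_def)
  show ?case
  proof (cases "m a = m b")
    case True
    define pre' where "pre' = pre @ ?j # dcode (Suc (length pre)) u"
    have len: "length pre' = ?lt" by (simp add: pre'_def)
    have "p = pre' @ dcode (length pre') t @ post"
      using Test.prems(1) unfolding len by (simp add: pre'_def)
    from Test.IH(1)[OF this k(2)] obtain pc where "pc < length p"
        "p ! pc = (if decide m t then Accept else Reject)" "run orc p k' (?lt, m) = return_pmf (pc, m)"
      unfolding len by (elim exE conjE) (rule that)
    then show ?thesis using True step k(1) by (intro exI[of _ pc]) (simp add: bind_return_pmf)
  next
    case False
    define pre' where "pre' = pre @ [?j]"
    have len: "length pre' = Suc (length pre)" by (simp add: pre'_def)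
    have "p = pre' @ dcode (length pre') u @ (dcode ?lt t @ post)"
      using Test.prems(1) unfolding len by (simp add: pre'_def)
    from Test.IH(2)[OF this k(3)] obtain pc where "pc < length p"
        "p ! pc = (if decide m u then Accept else Reject)" "run orc p k' (Suc (length pre), m) = return_pmf (pc, m)"
      unfolding len by (elim exE conjE) (rule that)
    then show ?thesis using False step k(1) by (intro exI[of _ pc]) (simp add: bind_return_pmf)
  qed
qed

text \<open>\<open>g\<close> enters the program only through its values at the leaves, so it may be
  any function, computable or not.\<close>

primrec build :: "(nat \<times> nat) list \<Rightarrow> (bool list \<Rightarrow> bool) \<Rightarrow> dtree" where
  "build [] g = Leaf (g [])"
| "build (c # cs) g = Test (fst c) (snd c) (build cs (\<lambda>bs. g (True # bs))) (build cs (\<lambda>bs. g (False # bs)))"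

lemma decide_build: "decide m (build cs g) = g (map (\<lambda>(a, b). m a = m b) cs)"
proof (induction cs arbitrary: g)
  case (Cons c cs)
  show ?case unfolding build.simps decide.simps Cons.IH by (cases c) simp
qed simp

text \<open>The equality matrix of the values, flattened row by row; the values themselves are
  forgotten.\<close>

definition pattern :: "('a \<Rightarrow> 'b) \<Rightarrow> 'a list \<Rightarrow> bool list" where
  "pattern f xs = map (\<lambda>(a, b). f a = f b) (List.product xs xs)"

lemma pattern_map: "pattern id (map f xs) = pattern f xs"
proof -
  have "List.product (map f xs) (map f ys) = map (map_prod f f) (List.product xs ys)" for ys
    by (induction xs) simp_all
  then show ?thesis by (simp add: pattern_def case_prod_beta)
qed

lemma pattern_eqD:
  assumes "pattern f xs = pattern g xs" "a \<in> set xs" "b \<in> set xs"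
  shows "f a = f b \<longleftrightarrow> g a = g b"
proof -
  have "(a, b) \<in> set (List.product xs xs)" using assms(2,3) by simp
  from bspec[OF assms(1)[unfolded pattern_def map_eq_conv] this] show ?thesis
    unfolding prod.case .
qed

text \<open>Program and time bound are fixed by \<open>k\<close>, \<open>ts\<close> and
  \<open>g\<close>, before \<open>n\<close> and the oracle are known: this makes the running time
  independent of \<open>n\<close>. After the draws everything is deterministic, so the probabilities
  of the verdicts are those of the sample.\<close>

lemma pattern_program:
  assumes ts: "\<And>t. t \<in> set ts \<Longrightarrow> regs t \<subseteq> {..k}"
  obtains p T where "\<And>n orc.
     (\<forall>s\<in>set_pmf (run orc p T (initial n)). accepting p s \<or> rejecting p s) \<and>
     measure_pmf.prob (run orc p T (initial n)) {s. accepting p s} =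
       measure_pmf.prob (replicate_pmf k (uniform_upto n)) {\<omega>. g (pattern (val orc (input_mem n \<omega>)) ts)} \<and>
     measure_pmf.prob (run orc p T (initial n)) {s. rejecting p s} =
       measure_pmf.prob (replicate_pmf k (uniform_upto n)) {\<omega>. \<not> g (pattern (val orc (input_mem n \<omega>)) ts)}"
proof -
  \<comment> \<open>Register 0 holds \<open>n\<close> and registers \<open>1..k\<close> the sample,
    together \<open>input_mem\<close>; those from \<open>Suc k\<close> on receive the values of
    \<open>ts\<close>, which the tree compares.\<close>
  define c1 where "c1 = map (\<lambda>i. Sample i 0) [1..<1 + k]"
  define c2 where "c2 = code_list (Suc k) ts"
  define rs where "rs = [Suc k..<Suc k + length ts]"
  define tree where "tree = build (List.product rs rs) g"
  define c where "c = c1 @ c2"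
  define p where "p = c @ dcode (length c) tree"
  define T where "T = length c + depth tree"
  have sc: "list_all straight c"
    by (simp add: c_def c1_def c2_def straight_code_list list.pred_map) (simp add: list.pred_set)
  have ex: "\<exists>fin. run orc p T (initial n) = map_pmf fin (replicate_pmf k (uniform_upto n)) \<and>
      (\<forall>\<omega>\<in>set_pmf (replicate_pmf k (uniform_upto n)).
        accepting p (fin \<omega>) = g (pattern (val orc (input_mem n \<omega>)) ts) \<and>
        rejecting p (fin \<omega>) = (\<not> g (pattern (val orc (input_mem n \<omega>)) ts)))" for n orc
  proof -
    let ?R = "replicate_pmf k (uniform_upto n)"
    define m0 where "m0 = (\<lambda>_::nat. 0::nat)(0 := n)"
    define mem where "mem \<omega> r = (if 1 \<le> r \<and> r < 1 + k then \<omega> ! (r - 1) else m0 r)" for \<omega> :: "nat list" and r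
    have e1: "effects orc c1 m0 = map_pmf mem ?R"
      using effects_sample[of 1 orc k m0] unfolding c1_def mem_def[abs_def] by (simp add: m0_def)
    have "\<forall>\<omega>. \<exists>m'. effects orc c2 (mem \<omega>) = return_pmf m' \<and> map m' rs = map (val orc (mem \<omega>)) ts"
    proof
      fix \<omega>
      have "\<exists>m'. effects orc (code_list (Suc k) ts) (mem \<omega>) = return_pmf m' \<and>
          map m' [Suc k..<Suc k + length ts] = map (val orc (mem \<omega>)) ts \<and> (\<forall>r<Suc k. m' r = mem \<omega> r)"
        by (rule effects_code_list) (use ts in \<open>simp add: lessThan_Suc_atMost\<close>)
      then show "\<exists>m'. effects orc c2 (mem \<omega>) = return_pmf m' \<and> map m' rs = map (val orc (mem \<omega>)) ts"
        unfolding c2_def rs_def by blast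
    qed
    then obtain m1 where m1: "\<And>\<omega>. effects orc c2 (mem \<omega>) = return_pmf (m1 \<omega>)"
      "\<And>\<omega>. map (m1 \<omega>) rs = map (val orc (mem \<omega>)) ts"
      using choice[of "\<lambda>\<omega> m'. effects orc c2 (mem \<omega>) = return_pmf m' \<and> map m' rs = map (val orc (mem \<omega>)) ts"]
      by blast
    have "effects orc c m0 = map_pmf m1 ?R"
      by (simp add: c_def effects_append e1 bind_map_pmf m1(1)) (simp add: map_pmf_def)
    then have r1: "run orc p (length c) (initial n) = map_pmf (\<lambda>\<omega>. (length c, m1 \<omega>)) ?R"
      using run_straight[OF sc, of p "[]" "dcode (length c) tree" orc m0]
      by (simp add: p_def initial_def m0_def map_pmf_comp)
    have "\<forall>\<omega>. \<exists>pc. pc < length p \<and> p ! pc = (if decide (m1 \<omega>) tree then Accept else Reject) \<and>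
        run orc p (depth tree) (length c, m1 \<omega>) = return_pmf (pc, m1 \<omega>)"
    proof
      fix \<omega>
      show "\<exists>pc. pc < length p \<and> p ! pc = (if decide (m1 \<omega>) tree then Accept else Reject) \<and>
        run orc p (depth tree) (length c, m1 \<omega>) = return_pmf (pc, m1 \<omega>)"
        by (rule run_dcode[where post = "[]"]) (simp_all add: p_def)
    qed
    then obtain pc where pc: "\<And>\<omega>. pc \<omega> < length p"
      "\<And>\<omega>. p ! pc \<omega> = (if decide (m1 \<omega>) tree then Accept else Reject)"
      "\<And>\<omega>. run orc p (depth tree) (length c, m1 \<omega>) = return_pmf (pc \<omega>, m1 \<omega>)"
      using choice[of "\<lambda>\<omega> pc. pc < length p \<and> p ! pc = (if decide (m1 \<omega>) tree then Accept else Reject) \<and>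
        run orc p (depth tree) (length c, m1 \<omega>) = return_pmf (pc, m1 \<omega>)"] by blast
    let ?fin = "\<lambda>\<omega>. (pc \<omega>, m1 \<omega>)"
    have "run orc p T (initial n) = map_pmf ?fin ?R"
      unfolding T_def run_add r1 bind_map_pmf pc(3) by (simp add: map_pmf_def)
    moreover have "decide (m1 \<omega>) tree = g (pattern (val orc (input_mem n \<omega>)) ts)" if "\<omega> \<in> set_pmf ?R" for \<omega>
    proof -
      have "length \<omega> = k" using that by (simp add: set_replicate_pmf)
      then have "mem \<omega> = input_mem n \<omega>"
        by (intro ext) (auto simp: mem_def input_mem_def m0_def nth_Cons split: nat.split)
      moreover have "decide (m1 \<omega>) tree = g (pattern (m1 \<omega>) rs)"
        by (simp add: tree_def decide_build pattern_def)
      moreover have "pattern (m1 \<omega>) rs = pattern (val orc (mem \<omega>)) ts"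
        unfolding pattern_map[of "m1 \<omega>", symmetric] pattern_map[of "val orc (mem \<omega>)", symmetric] m1(2) ..
      ultimately show ?thesis by simp
    qed
    ultimately show ?thesis
      by (intro exI[of _ ?fin] conjI ballI) (simp_all add: accepting_def rejecting_def pc(1,2))
  qed
  have "(\<forall>s\<in>set_pmf (run orc p T (initial n)). accepting p s \<or> rejecting p s) \<and>
     measure_pmf.prob (run orc p T (initial n)) {s. accepting p s} =
       measure_pmf.prob (replicate_pmf k (uniform_upto n)) {\<omega>. g (pattern (val orc (input_mem n \<omega>)) ts)} \<and>
     measure_pmf.prob (run orc p T (initial n)) {s. rejecting p s} =
       measure_pmf.prob (replicate_pmf k (uniform_upto n)) {\<omega>. \<not> g (pattern (val orc (input_mem n \<omega>)) ts)}"
    for n orc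
  proof -
    let ?R = "replicate_pmf k (uniform_upto n)" and ?g = "\<lambda>\<omega>. g (pattern (val orc (input_mem n \<omega>)) ts)"
    obtain fin where fin: "run orc p T (initial n) = map_pmf fin ?R" and
      fin': "\<forall>\<omega>\<in>set_pmf ?R. accepting p (fin \<omega>) = ?g \<omega> \<and> rejecting p (fin \<omega>) = (\<not> ?g \<omega>)"
      using ex[of orc n] by (elim exE conjE) (rule that)
    have "measure_pmf.prob ?R {\<omega>. accepting p (fin \<omega>)} = measure_pmf.prob ?R {\<omega>. ?g \<omega>}"
      by (rule measure_pmf.finite_measure_eq_AE) (auto simp: AE_measure_pmf_iff fin')
    moreover have "measure_pmf.prob ?R {\<omega>. rejecting p (fin \<omega>)} = measure_pmf.prob ?R {\<omega>. \<not> ?g \<omega>}"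
      by (rule measure_pmf.finite_measure_eq_AE) (auto simp: AE_measure_pmf_iff fin')
    ultimately show ?thesis
      using fin' unfolding fin by (simp add: vimage_def)
  qed
  then show thesis using that by blast
qed

section \<open>Exploring components\<close>

definition ctype :: "nat \<Rightarrow> nat \<Rightarrow> 'a ugraph \<Rightarrow> 'a \<Rightarrow> nat ugraph" where
  "ctype c d G v = type_of c d (induced G (component G v))"

text \<open>The order-free content of the oracle: the nonzero answers at a vertex are its
  neighbours. As 0 is not a vertex, it unambiguously encodes \<bottom>.\<close>

definition oracle_adj :: "nat \<Rightarrow> nat ugraph \<Rightarrow> oracle_fun \<Rightarrow> bool" where
  "oracle_adj d G orc \<longleftrightarrow> 0 \<notin> verts G \<and>
     (\<forall>v\<in>verts G. \<forall>u. adj G v u \<longleftrightarrow> u \<noteq> 0 \<and> (\<exists>i\<in>{1..d}. ask orc v i = u))"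

lemma oracle_adjI:
  assumes G: "G \<in> bounded_component_graphs c d" and "0 \<notin> verts G" "oracle_for d G orc"
  shows "oracle_adj d G orc"
  unfolding oracle_adj_def
proof (intro conjI ballI allI)
  fix v u assume v: "v \<in> verts G"
  note GD = bounded_component_graphsD[OF G]
  obtain f where f: "bij_betw f {1..degree G v} (neighbours G v)"
    "\<And>i. i \<in> {1..d} \<Longrightarrow> orc v i = (if i \<le> degree G v then Some (f i) else None)"
    using assms(3) v unfolding oracle_for_def by blast
  have nz: "adj G v u \<Longrightarrow> u \<noteq> 0" using sgraph_adj[OF GD(1)] assms(2) by metis
  show "adj G v u \<longleftrightarrow> u \<noteq> 0 \<and> (\<exists>i\<in>{1..d}. ask orc v i = u)"
  proof
    assume a: "adj G v u"
    then have "u \<in> f ` {1..degree G v}" using f(1) by (simp add: bij_betw_def neighbours_def)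
    then obtain i where i: "i \<in> {1..degree G v}" "u = f i" by blast
    have id: "i \<in> {1..d}" using i(1) GD(3)[OF v] by auto
    then have "ask orc v i = u" using f(2)[OF id] i by (simp add: ask_def)
    then show "u \<noteq> 0 \<and> (\<exists>i\<in>{1..d}. ask orc v i = u)" using nz[OF a] id by blast
  next
    assume "u \<noteq> 0 \<and> (\<exists>i\<in>{1..d}. ask orc v i = u)"
    then obtain i where i: "u \<noteq> 0" "i \<in> {1..d}" "ask orc v i = u" by blast
    then have "i \<le> degree G v \<and> u = f i" using f(2)[OF i(2)] by (auto simp: ask_def split: if_splits)
    then have "u \<in> neighbours G v" using bij_betwE[OF f(1)] i(2) by auto
    then show "adj G v u" by (simp add: neighbours_def)
  qed
qed (rule assms(2))

text \<open>
  A walk is a list of neighbour indices, the last step first. After an answer \<open>0\<close> the remaining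
  queries return junk, which \<open>valid_walk\<close> excludes.
\<close>

primrec walk :: "oracle_fun \<Rightarrow> nat \<Rightarrow> nat list \<Rightarrow> nat" where
  "walk orc v [] = v"
| "walk orc v (i # w) = ask orc (walk orc v w) i"

primrec valid_walk :: "oracle_fun \<Rightarrow> nat \<Rightarrow> nat list \<Rightarrow> bool" where
  "valid_walk orc v [] = True"
| "valid_walk orc v (i # w) \<longleftrightarrow> valid_walk orc v w \<and> ask orc (walk orc v w) i \<noteq> 0"

definition walks :: "nat \<Rightarrow> nat \<Rightarrow> nat list set" where
  "walks d K = {w. set w \<subseteq> {1..d} \<and> length w \<le> K}"

lemma finite_walks: "finite (walks d K)"
  unfolding walks_def by (rule finite_lists_length_le) simp

lemma walk_in_component:
  assumes "sgraph G" "oracle_adj d G orc" "v \<in> verts G" "set w \<subseteq> {1..d}" "valid_walk orc v w"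
  shows "walk orc v w \<in> component G v"
  using assms(4,5)
proof (induction w)
  case Nil
  then show ?case by (simp add: component_refl)
next
  case (Cons i w)
  then have w: "walk orc v w \<in> component G v" by simp
  then have "walk orc v w \<in> verts G" using component_subset[OF assms(1,3)] by blast
  then have "adj G (walk orc v w) (walk orc v (i # w))"
    using assms(2) Cons.prems unfolding oracle_adj_def by auto
  then show ?case using w by (simp add: component_def)
qed

text \<open>The adjacent pairs within the component form a relation with at most
  \<open>c * c\<close> elements, which bounds the length of a shortest path. The bound is crude but
  depends on \<open>c\<close> only.\<close>

lemma component_walk:
  assumes "sgraph G" "oracle_adj d G orc" "v \<in> verts G" "card (component G v) \<le> c" "u \<in> component G v"
  obtains w where "w \<in> walks d (c * c)" "valid_walk orc v w" "walk orc v w = u"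
proof -
  let ?C = "component G v"
  have sub: "?C \<subseteq> verts G" by (rule component_subset[OF assms(1,3)])
  have fin: "finite ?C" using sub assms(1) by (auto simp: sgraph_def intro: finite_subset)
  define R where "R = {(a, b). adj G a b \<and> a \<in> ?C}"
  have RC: "R \<subseteq> ?C \<times> ?C" unfolding R_def component_def by auto
  have finR: "finite R" using RC fin by (auto intro: finite_subset)
  have "card R \<le> card (?C \<times> ?C)" using RC fin by (intro card_mono) auto
  also have "\<dots> \<le> c * c" using assms(4) by (simp add: card_cartesian_product mult_le_mono)
  finally have cR: "card R \<le> c * c" .
  have "(adj G)\<^sup>*\<^sup>* v u" using assms(5) by (simp add: component_def)
  then have "(v, u) \<in> R\<^sup>*"
  proof (induction rule: rtranclp_induct)
    case (step a b)
    then have "(a, b) \<in> R" by (simp add: R_def component_def)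
    then show ?case using step.IH by simp
  qed simp
  then obtain k where k: "k \<le> card R" "(v, u) \<in> R ^^ k"
    using rtrancl_finite_eq_relpow[OF finR] by auto
  have "\<exists>w. set w \<subseteq> {1..d} \<and> length w = k \<and> valid_walk orc v w \<and> walk orc v w = u"
    using k(2)
  proof (induction k arbitrary: u)
    case (Suc k)
    then obtain y where y: "(v, y) \<in> R ^^ k" "(y, u) \<in> R" by auto
    obtain w where w: "set w \<subseteq> {1..d}" "length w = k" "valid_walk orc v w" "walk orc v w = y"
      using Suc.IH[OF y(1)] by blast
    have "adj G y u" "y \<in> verts G" using y(2) sub by (auto simp: R_def)
    then obtain i where "i \<in> {1..d}" "u \<noteq> 0" "ask orc y i = u"
      using assms(2) unfolding oracle_adj_def by blast
    then show ?case using w by (intro exI[of _ "i # w"]) simp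
  qed simp
  then obtain w where "set w \<subseteq> {1..d}" "length w = k" "valid_walk orc v w" "walk orc v w = u"
    by blast
  then show thesis using k(1) cR by (intro that[of w]) (simp_all add: walks_def)
qed

text \<open>The vertex reached by a walk is sent to the vertex reached by the same walk in the other
  graph. Coincidences of walks make this well defined and injective; zero answers tell which walks
  are valid. Adjacency of \<open>a\<close> and \<open>b\<close> is a coincidence between a walk to
  \<open>a\<close> prolonged by one step and a walk to \<open>b\<close>, hence the
  \<open>Suc\<close> in the length.\<close>

lemma components_iso:
  assumes G: "sgraph G" "oracle_adj d G orc" "v \<in> verts G" "card (component G v) \<le> c"
    and G': "sgraph G'" "oracle_adj d G' orc'" "v' \<in> verts G'" "card (component G' v') \<le> c"
    and eq: "\<And>w w1. w \<in> walks d (Suc (c * c)) \<Longrightarrow> w1 \<in> walks d (Suc (c * c)) \<Longrightarrow>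
      walk orc v w = walk orc v w1 \<longleftrightarrow> walk orc' v' w = walk orc' v' w1"
    and zero: "\<And>w. w \<in> walks d (Suc (c * c)) \<Longrightarrow> walk orc v w = 0 \<longleftrightarrow> walk orc' v' w = 0"
  shows "graph_iso (induced G (component G v)) (induced G' (component G' v'))"
proof -
  let ?C = "component G v" and ?C' = "component G' v'" and ?K = "c * c"
  have mono: "w \<in> walks d (Suc ?K)" if "w \<in> walks d ?K" for w using that by (simp add: walks_def)
  have ext: "i # w \<in> walks d (Suc ?K)" if "w \<in> walks d ?K" "i \<in> {1..d}" for i w
    using that by (simp add: walks_def)
  have valid: "valid_walk orc v w \<longleftrightarrow> valid_walk orc' v' w" if "w \<in> walks d (Suc ?K)" for w
    using that
  proof (induction w)
    case (Cons i w)
    then have "w \<in> walks d (Suc ?K)" by (simp add: walks_def)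
    then show ?case using Cons.IH zero[OF Cons.prems] by simp
  qed simp
  define f where "f u = walk orc' v' (SOME w. w \<in> walks d ?K \<and> valid_walk orc v w \<and> walk orc v w = u)" for u
  have f: "f (walk orc v w) = walk orc' v' w" if "w \<in> walks d ?K" "valid_walk orc v w" for w
  proof -
    let ?w = "SOME w'. w' \<in> walks d ?K \<and> valid_walk orc v w' \<and> walk orc v w' = walk orc v w"
    have "?w \<in> walks d ?K \<and> valid_walk orc v ?w \<and> walk orc v ?w = walk orc v w"
      by (rule someI[of _ w]) (use that in simp)
    then show ?thesis unfolding f_def using eq[OF mono mono, of ?w w] that(1) by blast
  qed
  have inC': "walk orc' v' w \<in> ?C'" if "w \<in> walks d ?K" "valid_walk orc v w" for w
    using walk_in_component[OF G'(1-3), of w] valid[OF mono[OF that(1)]] that by (simp add: walks_def)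
  have inC: "walk orc v w \<in> ?C" if "w \<in> walks d ?K" "valid_walk orc v w" for w
    using walk_in_component[OF G(1-3), of w] that by (simp add: walks_def)
  have "is_iso f (induced G ?C) (induced G' ?C')"
    unfolding is_iso_def bij_betw_def verts_induced
  proof (intro conjI ballI)
    show "inj_on f ?C"
    proof (rule inj_onI)
      fix a b assume ab: "a \<in> ?C" "b \<in> ?C" "f a = f b"
      obtain w where w: "w \<in> walks d ?K" "valid_walk orc v w" "walk orc v w = a"
        using component_walk[OF G ab(1)] .
      obtain w1 where w1: "w1 \<in> walks d ?K" "valid_walk orc v w1" "walk orc v w1 = b"
        using component_walk[OF G ab(2)] .
      have "walk orc' v' w = walk orc' v' w1" using ab(3) f[OF w(1,2)] f[OF w1(1,2)] w(3) w1(3) by simp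
      then show "a = b" using eq[OF mono[OF w(1)] mono[OF w1(1)]] w(3) w1(3) by simp
    qed
    show "f ` ?C = ?C'"
    proof
      show "f ` ?C \<subseteq> ?C'"
      proof
        fix y assume "y \<in> f ` ?C"
        then obtain a where a: "a \<in> ?C" "y = f a" by blast
        obtain w where w: "w \<in> walks d ?K" "valid_walk orc v w" "walk orc v w = a"
          using component_walk[OF G a(1)] .
        then show "y \<in> ?C'" using inC'[OF w(1,2)] f[OF w(1,2)] a(2) by simp
      qed
      show "?C' \<subseteq> f ` ?C"
      proof
        fix y assume y: "y \<in> ?C'"
        obtain w where w: "w \<in> walks d ?K" "valid_walk orc' v' w" "walk orc' v' w = y"
          using component_walk[OF G' y] .
        have "valid_walk orc v w" using valid[OF mono[OF w(1)]] w(2) by simp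
        then have "y = f (walk orc v w)" "walk orc v w \<in> ?C" using f inC w by simp_all
        then show "y \<in> f ` ?C" by blast
      qed
    qed
    fix a b assume ab: "a \<in> ?C" "b \<in> ?C"
    obtain w where w: "w \<in> walks d ?K" "valid_walk orc v w" "walk orc v w = a"
      using component_walk[OF G ab(1)] .
    obtain w1 where w1: "w1 \<in> walks d ?K" "valid_walk orc v w1" "walk orc v w1 = b"
      using component_walk[OF G ab(2)] .
    have fa: "f a = walk orc' v' w" "f b = walk orc' v' w1" using f w w1 by auto
    have C': "f a \<in> ?C'" "f b \<in> ?C'" using inC' w w1 fa by auto
    have V: "a \<in> verts G" "b \<in> verts G" "f a \<in> verts G'" "f b \<in> verts G'"
      using ab C' component_subset[OF G(1,3)] component_subset[OF G'(1,3)] by auto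
    have nz: "b \<noteq> 0" "f b \<noteq> 0" using V G(2) G'(2) unfolding oracle_adj_def by metis+
    have "ask orc a i = b \<longleftrightarrow> ask orc' (f a) i = f b" if "i \<in> {1..d}" for i
      using eq[OF ext[OF w(1) that] mono[OF w1(1)]] fa w(3) w1(3) by simp
    then have "adj G a b \<longleftrightarrow> adj G' (f a) (f b)"
      using V nz G(2) G'(2) unfolding oracle_adj_def by simp
    then show "adj (induced G ?C) a b \<longleftrightarrow> adj (induced G' ?C') (f a) (f b)"
      using ab C' by (simp add: adj_induced)
  qed
  then show ?thesis using graph_iso_iff by blast
qed

section \<open>The values compared by the tester\<close>

primrec walk_term :: "query_term \<Rightarrow> nat list \<Rightarrow> query_term" where
  "walk_term t [] = t"
| "walk_term t (i # w) = Ask (walk_term t w) (Cnst i)"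

lemma val_walk_term: "val orc m (walk_term t w) = walk orc (val orc m t) w"
  by (induction w) simp_all

lemma regs_walk_term: "regs (walk_term t w) = regs t"
  by (induction w) simp_all

text \<open>Compared with constants, \<open>Reg 0\<close> identifies a small \<open>n\<close>, the
  remainder yields \<open>n mod Q\<close>, and the \<open>Ask\<close> terms yield the edges of a
  small graph; the walk terms explore the components of the sample. The constants cover all these
  ranges and include 0, the code of \<bottom>.\<close>

definition tester_terms :: "nat \<Rightarrow> nat \<Rightarrow> nat \<Rightarrow> nat \<Rightarrow> nat \<Rightarrow> query_term set" where
  "tester_terms c d N Q k = {Reg 0, Rem (Reg 0) (Cnst Q)} \<union> Cnst ` {0..N + Q} \<union>
     (\<lambda>(v, i). Ask (Cnst v) (Cnst i)) ` ({0..N} \<times> {1..d}) \<union>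
     (\<lambda>(r, w). walk_term (Reg r) w) ` ({1..k} \<times> walks d (Suc (c * c)))"

lemma finite_tester_terms: "finite (tester_terms c d N Q k)"
  unfolding tester_terms_def by (simp add: finite_walks)

lemma regs_tester_terms: "t \<in> tester_terms c d N Q k \<Longrightarrow> regs t \<subseteq> {..k}"
  unfolding tester_terms_def by (auto simp: regs_walk_term)

definition verdict :: "nat \<Rightarrow> nat \<Rightarrow> fo_mod \<Rightarrow> nat \<Rightarrow> nat \<Rightarrow> nat ugraph \<Rightarrow> nat list \<Rightarrow> bool" where
  "verdict c d \<phi> N n G \<omega> \<longleftrightarrow> (if n < N then G \<in> property_of \<phi> \<inter> bounded_component_graphs c d
     else admits c d \<phi> n (ctype c d G ` set \<omega>))"

text \<open>For \<open>n < N\<close> the verdict does not look at the sample. This admits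
  \<open>n = 0\<close>, where every draw yields 0, which is not a vertex.\<close>

definition tester_input :: "nat \<Rightarrow> nat \<Rightarrow> nat \<Rightarrow> nat \<Rightarrow> nat \<Rightarrow> nat ugraph \<Rightarrow> oracle_fun \<Rightarrow> nat list \<Rightarrow> bool" where
  "tester_input c d N k n G orc \<omega> \<longleftrightarrow> G \<in> bounded_component_graphs c d \<and> verts G = {1..n} \<and>
     oracle_for d G orc \<and> length \<omega> = k \<and> (N \<le> n \<longrightarrow> set \<omega> \<subseteq> {1..n})"

text \<open>The two inputs may differ in size, graph, oracle and vertex names; equal patterns still
  force equal verdicts. This makes a table indexed by patterns well defined.\<close>

lemma verdict_pattern:
  assumes I: "tester_input c d N k n G orc \<omega>" and I': "tester_input c d N k n' G' orc' \<omega>'"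
    and Q: "Q = modulus \<phi> * fact c" "0 < Q"
    and same: "\<And>t u. t \<in> tester_terms c d N Q k \<Longrightarrow> u \<in> tester_terms c d N Q k \<Longrightarrow>
      val orc (input_mem n \<omega>) t = val orc (input_mem n \<omega>) u \<longleftrightarrow>
      val orc' (input_mem n' \<omega>') t = val orc' (input_mem n' \<omega>') u"
  shows "verdict c d \<phi> N n G \<omega> \<longleftrightarrow> verdict c d \<phi> N n' G' \<omega>'"
proof -
  let ?T = "tester_terms c d N Q k"
  have G: "G \<in> bounded_component_graphs c d" "verts G = {1..n}" "oracle_for d G orc" "length \<omega> = k"
    using I by (auto simp: tester_input_def)
  have G': "G' \<in> bounded_component_graphs c d" "verts G' = {1..n'}" "oracle_for d G' orc'" "length \<omega>' = k"
    using I' by (auto simp: tester_input_def)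
  note GD = bounded_component_graphsD[OF G(1)] and GD' = bounded_component_graphsD[OF G'(1)]
  have oa: "oracle_adj d G orc" "oracle_adj d G' orc'"
    using oracle_adjI[OF G(1) _ G(3)] oracle_adjI[OF G'(1) _ G'(3)] G(2) G'(2) by auto
  have K: "Reg 0 \<in> ?T" "Rem (Reg 0) (Cnst Q) \<in> ?T" "\<And>a. a \<le> N + Q \<Longrightarrow> Cnst a \<in> ?T"
    "\<And>a i. a \<le> N \<Longrightarrow> i \<in> {1..d} \<Longrightarrow> Ask (Cnst a) (Cnst i) \<in> ?T"
    "\<And>r w. r \<in> {1..k} \<Longrightarrow> w \<in> walks d (Suc (c * c)) \<Longrightarrow> walk_term (Reg r) w \<in> ?T"
    unfolding tester_terms_def by auto
  have n_eq: "n = a \<longleftrightarrow> n' = a" if "a \<le> N" for a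
    using same[OF K(1) K(3)[of a]] that by (simp add: input_mem_def)
  have mod_eq: "n mod Q = n' mod Q"
  proof -
    have "n mod Q \<le> N + Q" using mod_less_divisor[OF Q(2), of n] by linarith
    then show ?thesis using same[OF K(2) K(3)[of "n mod Q"]] by (simp add: input_mem_def)
  qed
  show ?thesis
  proof (cases "n < N")
    case True
    then have n': "n' = n" using n_eq[of n] by simp
    \<comment> \<open>The answers are compared with constants, so a small graph is recovered
      together with its vertex names: the graphs are equal, not merely isomorphic.\<close>
    have "adj G u v \<longleftrightarrow> adj G' u v" if uv: "u \<in> {1..n}" "v \<in> {1..n}" for u v
    proof -
      have "ask orc u i = v \<longleftrightarrow> ask orc' u i = v" if "i \<in> {1..d}" for i
        using same[OF K(4)[of u i] K(3)[of v]] that uv True by simp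
      then show ?thesis using oa uv G(2) G'(2) n' unfolding oracle_adj_def by simp
    qed
    then have "edges G \<subseteq> edges G' \<and> edges G' \<subseteq> edges G"
      using sgraph_edge_obtain[OF GD(1)] sgraph_edge_obtain[OF GD'(1)] G(2) G'(2) n'
      unfolding adj_def by (metis subsetI)
    then have "G = G'" using G(2) G'(2) n' by (intro ugraph.equality) auto
    then show ?thesis using True n' by (simp add: verdict_def)
  next
    case False
    then have "N \<le> n" "N \<le> n'" using n_eq[of n'] by linarith+
    then have sub: "set \<omega> \<subseteq> {1..n}" "set \<omega>' \<subseteq> {1..n'}" using I I' by (auto simp: tester_input_def)
    have types: "ctype c d G (\<omega> ! i) = ctype c d G' (\<omega>' ! i)" if i: "i < k" for i
    proof -
      have V: "\<omega> ! i \<in> verts G" "\<omega>' ! i \<in> verts G'"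
        using i G(2,4) G'(2,4) sub nth_mem by (metis subsetD)+
      have m: "input_mem n \<omega> (Suc i) = \<omega> ! i" "input_mem n' \<omega>' (Suc i) = \<omega>' ! i"
        using i G(4) G'(4) by (simp_all add: input_mem_def)
      have r: "Suc i \<in> {1..k}" using i by simp
      show ?thesis unfolding ctype_def
      proof (rule type_of_cong, rule components_iso[OF GD(1) oa(1) V(1) GD(4)[OF V(1)] GD'(1) oa(2) V(2) GD'(4)[OF V(2)]])
        fix w w1 assume "w \<in> walks d (Suc (c * c))" "w1 \<in> walks d (Suc (c * c))"
        then show "walk orc (\<omega> ! i) w = walk orc (\<omega> ! i) w1 \<longleftrightarrow> walk orc' (\<omega>' ! i) w = walk orc' (\<omega>' ! i) w1"
          using same[OF K(5)[OF r] K(5)[OF r]] by (simp add: val_walk_term m)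
      next
        fix w assume "w \<in> walks d (Suc (c * c))"
        then show "walk orc (\<omega> ! i) w = 0 \<longleftrightarrow> walk orc' (\<omega>' ! i) w = 0"
          using same[OF K(5)[OF r] K(3)[of 0]] by (simp add: val_walk_term m)
      qed
    qed
    have "map (ctype c d G) \<omega> = map (ctype c d G') \<omega>'"
      using types G(4) G'(4) by (intro nth_equalityI) auto
    then have "ctype c d G ` set \<omega> = ctype c d G' ` set \<omega>'" by (metis set_map)
    then show ?thesis using \<open>N \<le> n\<close> \<open>N \<le> n'\<close> mod_eq by (simp add: verdict_def admits_def Q(1))
  qed
qed

section \<open>Sampling\<close>

lemma prob_replicate_subset:
  fixes p :: "'a :: countable pmf"
  shows "measure_pmf.prob (replicate_pmf k p) {xs. set xs \<subseteq> A} = measure_pmf.prob p A ^ k"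
proof (induction k)
  case (Suc k)
  have "replicate_pmf (Suc k) p = map_pmf (\<lambda>(x, xs). x # xs) (pair_pmf p (replicate_pmf k p))"
    by (simp add: pair_pmf_def map_bind_pmf)
  moreover have "(\<lambda>(x, xs). x # xs) -` {xs. set xs \<subseteq> A} = A \<times> {xs. set xs \<subseteq> A}"
    by auto
  ultimately show ?case
    by (simp only: measure_map_pmf measure_pmf_prob_product[OF countableI_type countableI_type] Suc.IH power_Suc)
qed simp

lemma prob_uniform_upto:
  "0 < n \<Longrightarrow> measure_pmf.prob (uniform_upto n) X = real (card ({1..n} \<inter> X)) / real n"
  by (simp add: uniform_upto_def measure_pmf_of_set)

lemma prob_replicate_avoid:
  assumes "0 < n"
  shows "measure_pmf.prob (replicate_pmf k (uniform_upto n)) {\<omega>. set \<omega> \<subseteq> - X} =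
    (1 - real (card ({1..n} \<inter> X)) / real n) ^ k"
proof -
  have "measure_pmf.prob (uniform_upto n) (- X) = 1 - measure_pmf.prob (uniform_upto n) X"
    using measure_pmf.prob_compl[of X "uniform_upto n"] unfolding Compl_eq_Diff_UNIV by simp
  then show ?thesis by (simp only: prob_replicate_subset prob_uniform_upto[OF assms])
qed

lemma type_class_card:
  assumes f: "is_iso f (copies x) G" and fT: "\<And>T k v. (T, k, v) \<in> verts (copies x) \<Longrightarrow>
       ctype c d G (f (T, k, v)) = T"
  shows "card {v \<in> verts G. ctype c d G v = T} = x T * card (verts T)"
proof -
  have bij: "bij_betw f (verts (copies x)) (verts G)" using f by (simp add: is_iso_def)
  have "{v \<in> verts G. ctype c d G v = T} = (\<lambda>(k, v). f (T, k, v)) ` ({..<x T} \<times> verts T)"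
  proof (intro equalityI subsetI)
    fix w assume w: "w \<in> {v \<in> verts G. ctype c d G v = T}"
    then have "w \<in> f ` verts (copies x)" using bij by (simp add: bij_betw_def)
    then obtain S k v where s: "(S, k, v) \<in> verts (copies x)" "w = f (S, k, v)" by auto
    then have "S = T" using fT w by auto
    then show "w \<in> (\<lambda>(k, v). f (T, k, v)) ` ({..<x T} \<times> verts T)"
      using s by (auto simp: verts_copies)
  next
    fix w assume "w \<in> (\<lambda>(k, v). f (T, k, v)) ` ({..<x T} \<times> verts T)"
    then obtain k v where "w = f (T, k, v)" "(T, k, v) \<in> verts (copies x)"
      by (auto simp: verts_copies)
    then show "w \<in> {v \<in> verts G. ctype c d G v = T}" using fT is_iso_mem[OF f] by simp
  qed
  moreover have "inj_on (\<lambda>(k, v). f (T, k, v)) ({..<x T} \<times> verts T)"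
  proof (rule inj_onI)
    fix p q assume pq: "p \<in> {..<x T} \<times> verts T" "q \<in> {..<x T} \<times> verts T"
      "(case p of (k, v) \<Rightarrow> f (T, k, v)) = (case q of (k, v) \<Rightarrow> f (T, k, v))"
    then have "(T, p) = (T, q)"
      using bij by (intro inj_onD[of f "verts (copies x)"]) (auto simp: bij_betw_def verts_copies)
    then show "p = q" by simp
  qed
  ultimately show ?thesis by (simp only: card_image card_cartesian_product card_lessThan)
qed

text \<open>\<open>b\<close> stands for the number of vertices of types below the threshold. By
  Bernoulli's inequality a sample avoids them with probability at least
  \<open>1 - k * b / n\<close>. The factor \<open>Suc k\<close> secures \<open>b \<le> n\<close>
  even for \<open>k = 0\<close>.\<close>

lemma completeness_bound:
  assumes n: "0 < n" "3 * Suc k * (m * (t * c)) \<le> n" and b: "b \<le> m * (t * c)"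
  shows "2 / 3 \<le> (1 - real b / real n) ^ k"
proof -
  have b: "3 * Suc k * b \<le> n" by (rule order_trans[OF mult_le_mono2[OF b] n(2)])
  have "b \<le> 3 * Suc k * b" by simp
  then have "b \<le> n" using b by (rule order_trans)
  have "3 * k * b \<le> 3 * Suc k * b" by simp
  then have kb: "3 * k * b \<le> n" using b by (rule order_trans)
  have "real (3 * k * b) \<le> real n" using kb by (rule of_nat_mono)
  then have "real k * (real b / real n) \<le> 1 / 3" using n(1) by (simp add: field_simps)
  moreover have "1 + real k * (- (real b / real n)) \<le> (1 + - (real b / real n)) ^ k"
    using \<open>b \<le> n\<close> n(1) by (intro Bernoulli_inequality) simp
  ultimately show ?thesis by simp
qed

text \<open>Supplies \<open>l1\<close> and \<open>l2\<close> of \<open>admits_close\<close> with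
  \<open>B = D + K\<close>. The square \<open>(m + 1)\<^sup>2\<close> dominates both
  \<open>m\<close> and \<open>m * m\<close> and is positive even for \<open>m = 0\<close>; the
  factors 4 and 8 make the summands fit into \<open>\<epsilon> * n\<close> together.\<close>

lemma size_bounds:
  fixes \<epsilon> :: real and m n D K a :: nat
  assumes \<epsilon>: "0 < \<epsilon>" "\<epsilon> \<le> 1" and n: "8 * (real m + 1)\<^sup>2 * real K / \<epsilon> \<le> real n"
    and D: "real D \<le> \<epsilon> / (4 * (real m + 1)\<^sup>2) * real n" and a: "a \<le> K"
  shows "real (2 * m * (D + K)) \<le> \<epsilon> * real n" "m * (m * (D + K) + a) \<le> n"
proof -
  define q where "q = (real m + 1)\<^sup>2"
  have q: "0 < q" "real m \<le> q" "real m * real m \<le> q" "0 \<le> real m"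
    by (simp_all add: q_def power2_eq_square algebra_simps add_pos_nonneg)
  have K: "8 * q * real K \<le> \<epsilon> * real n" using n \<epsilon>(1) by (simp add: q_def field_simps)
  have D': "4 * q * real D \<le> \<epsilon> * real n" using D[folded q_def] q(1) by (simp add: field_simps)
  have 1: "real m * real D \<le> q * real D" "real m * real K \<le> q * real K"
    "real m * real m * real D \<le> q * real D" "real m * real m * real K \<le> q * real K"
    using q by (intro mult_right_mono; simp)+
  have "real m * real a \<le> real m * real K" using a by (intro mult_left_mono) simp_all
  then have 2: "real m * real a \<le> q * real K" using 1 by linarith
  have en: "\<epsilon> * real n \<le> real n" "0 \<le> \<epsilon> * real n" using \<epsilon> by (auto intro: mult_left_le_one_le)
  have "real (2 * m * (D + K)) = 2 * (real m * real D) + 2 * (real m * real K)"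
    by (simp add: algebra_simps)
  then show "real (2 * m * (D + K)) \<le> \<epsilon> * real n" using 1 K D' en by linarith
  have "real (m * (m * (D + K) + a)) = real m * real m * real D + real m * real m * real K + real m * real a"
    by (simp add: algebra_simps)
  then have "real (m * (m * (D + K) + a)) \<le> real n" using 1 2 K D' en by linarith
  then show "m * (m * (D + K) + a) \<le> n" by (simp only: of_nat_le_iff)
qed

lemma eps_far_not_mem:
  assumes "sgraph G" "0 \<le> \<epsilon>" "eps_far \<epsilon> d G P"
  shows "G \<notin> P"
proof
  assume "G \<in> P"
  have "graph_dist G G \<le> edit_cost G G" by (rule graph_dist_le[OF assms(1) refl])
  then have "eps_close \<epsilon> d G G" using assms(2) by (simp add: eps_close_def edit_cost_def)
  then show False using assms(3) \<open>G \<in> P\<close> by (auto simp: eps_far_def)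
qed

lemma set_replicate_uniform:
  assumes "\<omega> \<in> set_pmf (replicate_pmf k (uniform_upto n))"
  shows "length \<omega> = k" "0 < n \<Longrightarrow> set \<omega> \<subseteq> {1..n}"
  using assms by (auto simp: set_replicate_pmf uniform_upto_def)

lemma prob_mono_AE:
  assumes "\<And>\<omega>. \<omega> \<in> set_pmf p \<Longrightarrow> \<omega> \<in> A \<Longrightarrow> \<omega> \<in> B"
  shows "measure_pmf.prob p A \<le> measure_pmf.prob p B"
  by (rule measure_pmf.finite_measure_mono_AE) (use assms in \<open>auto simp: AE_measure_pmf_iff\<close>)

section \<open>Error probabilities of the verdict\<close>

lemma verdict_complete:
  assumes \<phi>: "sentence \<phi>" and G: "G \<in> property_of \<phi> \<inter> bounded_component_graphs c d"
    and vG: "verts G = {1..n}" and n: "0 < n" "N \<le> n"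
      "3 * Suc k * (card (small_graphs c d) * (qdepth \<phi> * c)) \<le> n"
  shows "2 / 3 \<le> measure_pmf.prob (replicate_pmf k (uniform_upto n)) {\<omega>. verdict c d \<phi> N n G \<omega>}"
proof -
  let ?S = "small_graphs c d" and ?R = "replicate_pmf k (uniform_upto n)" and ?t = "qdepth \<phi>"
  have Gb: "G \<in> bounded_component_graphs c d" using G by simp
  obtain x f where x: "\<And>T. T \<notin> ?S \<Longrightarrow> x T = 0" and f: "is_iso f (copies x) G"
    and fT: "\<And>T k v. (T, k, v) \<in> verts (copies x) \<Longrightarrow> ctype c d G (f (T, k, v)) = T"
    using decomposition[OF Gb] unfolding ctype_def by blast
  have sx: "supported c d x" using x by (simp add: supported_def)
  have "card (verts (copies x)) = card (verts G)"
    using f by (intro bij_betw_same_card[of f]) (simp add: is_iso_def)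
  then have tot: "total_size c d x = n" by (simp add: card_verts_copies[OF sx] vG)
  have cT: "card {v \<in> verts G. ctype c d G v = T} = x T * card (verts T)" for T
    by (rule type_class_card[OF f]) (rule fT)
  \<comment> \<open>The vertices that could mislead the tester. Fewer than \<open>?t\<close> copies
    of at most \<open>c\<close> vertices for each of the types leave at most
    \<open>card ?S * (?t * c)\<close> of them, whatever \<open>n\<close> is.\<close>
  define X where "X = {v \<in> verts G. x (ctype c d G v) < ?t}"
  have "X \<subseteq> (\<Union>T\<in>{T \<in> ?S. x T < ?t}. {v \<in> verts G. ctype c d G v = T})"
    using type_of_spec[OF Gb] by (auto simp: X_def ctype_def)
  then have "card X \<le> card (\<Union>T\<in>{T \<in> ?S. x T < ?t}. {v \<in> verts G. ctype c d G v = T})"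
    by (rule card_mono[rotated]) (use finite_small_graphs vG in auto)
  also have "\<dots> \<le> (\<Sum>T\<in>{T \<in> ?S. x T < ?t}. card {v \<in> verts G. ctype c d G v = T})"
    by (rule card_UN_le) (use finite_small_graphs in simp)
  also have "\<dots> \<le> (\<Sum>T\<in>{T \<in> ?S. x T < ?t}. ?t * c)"
  proof (rule sum_mono)
    fix T assume "T \<in> {T \<in> ?S. x T < ?t}"
    then show "card {v \<in> verts G. ctype c d G v = T} \<le> ?t * c"
      unfolding cT using small_graphsD(4)[of T c d] by (intro mult_le_mono) auto
  qed
  also have "\<dots> = card {T \<in> ?S. x T < ?t} * (?t * c)" by simp
  also have "\<dots> \<le> card ?S * (?t * c)"
    by (intro mult_le_mono1 card_mono finite_small_graphs) auto
  finally have "card X \<le> card ?S * (?t * c)" .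
  moreover have "{1..n} \<inter> X = X"
    by (rule Int_absorb1) (simp only: X_def vG Collect_restrict)
  ultimately have 1: "2 / 3 \<le> measure_pmf.prob ?R {\<omega>. set \<omega> \<subseteq> - X}"
    unfolding prob_replicate_avoid[OF n(1)] by (simp only: completeness_bound[OF n(1,3)])
  have "measure_pmf.prob ?R {\<omega>. set \<omega> \<subseteq> - X} \<le> measure_pmf.prob ?R {\<omega>. verdict c d \<phi> N n G \<omega>}"
  proof (rule prob_mono_AE)
    fix \<omega> assume w: "\<omega> \<in> set_pmf ?R" "\<omega> \<in> {\<omega>. set \<omega> \<subseteq> - X}"
    have sub: "set \<omega> \<subseteq> verts G" using set_replicate_uniform(2)[OF w(1) n(1)] vG by simp
    have "admits c d \<phi> n (ctype c d G ` set \<omega>)"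
    proof (rule admits_complete[OF \<phi> _ f sx tot])
      show "G \<in> property_of \<phi>" using G by simp
      fix T assume "T \<in> ctype c d G ` set \<omega>"
      then obtain v where "v \<in> set \<omega>" "T = ctype c d G v" by auto
      then show "?t \<le> x T" using w(2) sub by (auto simp: X_def not_less)
    qed
    then show "\<omega> \<in> {\<omega>. verdict c d \<phi> N n G \<omega>}" using n(2) by (simp add: verdict_def)
  qed
  with 1 show ?thesis by (rule order_trans)
qed

text \<open>By \<open>admits_close\<close>, a far graph is accepted only if the sample misses some
  type with more than \<open>\<delta> * n\<close> vertices. Each such type is missed with
  probability at most \<open>(1 - \<delta>) ^ k\<close>, and a union bound over at most
  \<open>m\<close> types remains.\<close>

lemma verdict_sound:
  fixes \<epsilon> :: real
  assumes \<phi>: "sentence \<phi>" and Gb: "G \<in> bounded_component_graphs c d"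
    and vG: "verts G = {1..n}" and n: "0 < n" "N \<le> n"
    and \<epsilon>: "0 < \<epsilon>" "\<epsilon> \<le> 1"
    and far: "eps_far \<epsilon> d G (property_of \<phi> \<inter> bounded_component_graphs c d)"
    and m: "m = card (small_graphs c d)"
    and \<delta>: "\<delta> = \<epsilon> / (4 * (real m + 1)\<^sup>2)"
    and n1: "8 * (real m + 1)\<^sup>2 * real (c * (qdepth \<phi> + modulus \<phi> * fact c)) / \<epsilon> \<le> real n"
    and k: "real m * (1 - \<delta>) ^ k \<le> 1 / 3"
  shows "measure_pmf.prob (replicate_pmf k (uniform_upto n)) {\<omega>. verdict c d \<phi> N n G \<omega>} \<le> 1 / 3"
proof -
  let ?S = "small_graphs c d" and ?R = "replicate_pmf k (uniform_upto n)"
  let ?s = "\<lambda>T. card (verts T)"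
  note GD = bounded_component_graphsD[OF Gb]
  obtain x f where x: "\<And>T. T \<notin> ?S \<Longrightarrow> x T = 0" and f: "is_iso f (copies x) G"
    and fT: "\<And>T k v. (T, k, v) \<in> verts (copies x) \<Longrightarrow> ctype c d G (f (T, k, v)) = T"
    using decomposition[OF Gb] unfolding ctype_def by blast
  have sx: "supported c d x" using x by (simp add: supported_def)
  have "card (verts (copies x)) = card (verts G)"
    using f by (intro bij_betw_same_card[of f]) (simp add: is_iso_def)
  then have tot: "total_size c d x = n" by (simp add: card_verts_copies[OF sx] vG)
  have cT: "card {v \<in> verts G. ctype c d G v = T} = x T * card (verts T)" for T
    by (rule type_class_card[OF f]) (rule fT)
  define D where "D = nat \<lfloor>\<delta> * real n\<rfloor>"
  have \<delta>0: "0 \<le> \<delta>" using \<epsilon> by (simp add: \<delta>)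
  have D: "real D \<le> \<delta> * real n" using \<delta>0 by (simp add: D_def)
  define L where "L = {T \<in> ?S. D < x T * ?s T}"
  have finL: "finite L" using finite_small_graphs by (simp add: L_def)
  define X where "X T = {v \<in> verts G. ctype c d G v = T}" for T
  let ?K = "c * (qdepth \<phi> + modulus \<phi> * fact c)"
  have "c * qdepth \<phi> \<le> ?K" by simp
  note bounds = size_bounds[OF \<epsilon> n1 D[unfolded \<delta>] this]
  have 1: "measure_pmf.prob ?R {\<omega>. verdict c d \<phi> N n G \<omega>} \<le>
      measure_pmf.prob ?R (\<Union>T\<in>L. {\<omega>. set \<omega> \<subseteq> - X T})"
  proof (rule prob_mono_AE)
    fix \<omega> assume w: "\<omega> \<in> set_pmf ?R" "\<omega> \<in> {\<omega>. verdict c d \<phi> N n G \<omega>}"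
    then have adm: "admits c d \<phi> n (ctype c d G ` set \<omega>)" using n(2) by (simp add: verdict_def)
    show "\<omega> \<in> (\<Union>T\<in>L. {\<omega>. set \<omega> \<subseteq> - X T})"
    proof (rule ccontr)
      assume no: "\<not> ?thesis"
      have rare: "x T * ?s T \<le> D" if "T \<in> ?S" "T \<notin> ctype c d G ` set \<omega>" for T
      proof (rule ccontr)
        assume "\<not> x T * ?s T \<le> D"
        then have "T \<in> L" using that(1) by (simp add: L_def)
        moreover have "set \<omega> \<subseteq> - X T" using that(2) by (auto simp: X_def)
        ultimately show False using no by blast
      qed
      have "\<exists>H\<in>property_of \<phi> \<inter> bounded_component_graphs c d. eps_close \<epsilon> d G H"
        by (rule admits_close[OF \<phi> GD(1) f sx tot n(1) adm _ refl m bounds(1) \<epsilon>(2) bounds(2)]) (rule rare)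
      then show False using far by (simp add: eps_far_def)
    qed
  qed
  have 2: "measure_pmf.prob ?R (\<Union>T\<in>L. {\<omega>. set \<omega> \<subseteq> - X T}) \<le>
      (\<Sum>T\<in>L. measure_pmf.prob ?R {\<omega>. set \<omega> \<subseteq> - X T})"
    by (rule measure_pmf.finite_measure_subadditive_finite[OF finL]) simp
  have 3: "(\<Sum>T\<in>L. measure_pmf.prob ?R {\<omega>. set \<omega> \<subseteq> - X T}) \<le> (\<Sum>T\<in>L. (1 - \<delta>) ^ k)"
  proof (rule sum_mono)
    fix T assume T: "T \<in> L"
    have XT: "{1..n} \<inter> X T = X T"
      by (rule Int_absorb1) (simp only: X_def vG Collect_restrict)
    have cX: "card (X T) = x T * ?s T" unfolding X_def by (rule cT)
    have "\<lfloor>\<delta> * real n\<rfloor> < int (card (X T))" using T \<delta>0 unfolding cX by (simp add: L_def D_def nat_less_iff)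
    then have "\<delta> * real n \<le> real (card (X T))" by linarith
    then have 1: "\<delta> \<le> real (card (X T)) / real n" using n(1) by (simp add: field_simps)
    have "card (X T) \<le> card (verts G)" by (rule card_mono) (use GD(2) in \<open>auto simp: X_def\<close>)
    then have 2: "real (card (X T)) / real n \<le> 1" using n(1) vG by simp
    show "measure_pmf.prob ?R {\<omega>. set \<omega> \<subseteq> - X T} \<le> (1 - \<delta>) ^ k"
      unfolding prob_replicate_avoid[OF n(1)] XT using 1 2 by (intro power_mono) auto
  qed
  have 4: "real (card L) * (1 - \<delta>) ^ k \<le> real m * (1 - \<delta>) ^ k"
  proof (rule mult_right_mono)
    have "card L \<le> m" unfolding m by (rule card_mono[OF finite_small_graphs]) (auto simp: L_def)
    then show "real (card L) \<le> real m" by simp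
    have "1 \<le> (real m + 1)\<^sup>2" by (simp add: power2_eq_square algebra_simps)
    then have "\<epsilon> \<le> 4 * (real m + 1)\<^sup>2" using \<epsilon> by linarith
    then have "\<delta> \<le> 1" by (simp add: \<delta> divide_le_eq)
    then show "0 \<le> (1 - \<delta>) ^ k" by simp
  qed
  have "(\<Sum>T\<in>L. (1 - \<delta>) ^ k) = real (card L) * (1 - \<delta>) ^ k" by simp
  with 1 2 3 4 k show ?thesis by linarith
qed

theorem theorem4p1:
  fixes c d :: nat and \<phi> :: fo_mod
  assumes "sentence \<phi>"
  shows "uniformly_testable_const_time d
           (property_of \<phi> \<inter> bounded_component_graphs c d) (bounded_component_graphs c d)"
  unfolding uniformly_testable_const_time_def
proof (intro allI impI)
  fix \<epsilon> :: real assume "0 < \<epsilon> \<and> \<epsilon> \<le> 1"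
  then have \<epsilon>: "0 < \<epsilon>" "\<epsilon> \<le> 1" by auto
  let ?P = "property_of \<phi> \<inter> bounded_component_graphs c d"
  define m where "m = card (small_graphs c d)"
  define Q where "Q = modulus \<phi> * fact c"
  have Q: "0 < Q" using assms by (simp add: Q_def sentence_def modulus_pos)
  \<comment> \<open>A type counts as frequent if it fills more than the fraction \<delta> of the
    vertices; the denominator is the one required by \<open>size_bounds\<close>.\<close>
  define \<delta> where "\<delta> = \<epsilon> / (4 * (real m + 1)\<^sup>2)"
  have "0 < \<delta>" using \<epsilon> by (simp add: \<delta>_def add_nonneg_pos)
  \<comment> \<open>The sample size brings the union bound over \<open>m\<close> types down to 1/3;
    \<open>m + 1\<close> keeps the divisor positive.\<close>
  then obtain k where "(1 - \<delta>) ^ k < 1 / (3 * (real m + 1))"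
    using real_arch_pow_inv[of "1 / (3 * (real m + 1))" "1 - \<delta>"] by auto
  then have "real m * (1 - \<delta>) ^ k \<le> real m * (1 / (3 * (real m + 1)))"
    by (intro mult_left_mono) auto
  also have "\<dots> \<le> 1 / 3" by (simp add: field_simps)
  finally have k: "real m * (1 - \<delta>) ^ k \<le> 1 / 3" .
  \<comment> \<open>The sum of the lower bounds on \<open>n\<close> demanded by completeness and
    soundness, plus 1 so that \<open>N \<le> n\<close> gives \<open>0 < n\<close>. The bound for
    completeness grows with \<open>k\<close>, so \<open>N\<close> is chosen after the sample
    size.\<close>
  define N where "N = Suc (3 * Suc k * (m * (qdepth \<phi> * c)) +
    nat \<lceil>8 * (real m + 1)\<^sup>2 * real (c * (qdepth \<phi> + modulus \<phi> * fact c)) / \<epsilon>\<rceil>)"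
  obtain ts where ts: "set ts = tester_terms c d N Q k"
    using finite_list[OF finite_tester_terms] by blast
  \<comment> \<open>The pattern need not be decoded: it suffices that some input with this pattern is accepted.\<close>
  define g where "g bs \<longleftrightarrow> (\<exists>n G orc \<omega>. tester_input c d N k n G orc \<omega> \<and>
    pattern (val orc (input_mem n \<omega>)) ts = bs \<and> verdict c d \<phi> N n G \<omega>)" for bs
  obtain p T where p: "\<And>n orc.
     (\<forall>s\<in>set_pmf (run orc p T (initial n)). accepting p s \<or> rejecting p s) \<and>
     measure_pmf.prob (run orc p T (initial n)) {s. accepting p s} =
       measure_pmf.prob (replicate_pmf k (uniform_upto n)) {\<omega>. g (pattern (val orc (input_mem n \<omega>)) ts)} \<and>
     measure_pmf.prob (run orc p T (initial n)) {s. rejecting p s} =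
       measure_pmf.prob (replicate_pmf k (uniform_upto n)) {\<omega>. \<not> g (pattern (val orc (input_mem n \<omega>)) ts)}"
  proof (rule pattern_program)
    show "regs t \<subseteq> {..k}" if "t \<in> set ts" for t by (rule regs_tester_terms[OF that[unfolded ts]])
  qed (rule that)
  have "(\<forall>s\<in>set_pmf (run orc p T (initial n)). accepting p s \<or> rejecting p s) \<and>
      (G \<in> ?P \<longrightarrow> measure_pmf.prob (run orc p T (initial n)) {s. accepting p s} \<ge> 2 / 3) \<and>
      (eps_far \<epsilon> d G ?P \<longrightarrow> measure_pmf.prob (run orc p T (initial n)) {s. rejecting p s} \<ge> 2 / 3)"
    if Gb: "G \<in> bounded_component_graphs c d" and vG: "verts G = {1..n}" and orc: "oracle_for d G orc" for n G orc
  proof -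
    let ?R = "replicate_pmf k (uniform_upto n)"
    let ?V = "\<lambda>\<omega>. verdict c d \<phi> N n G \<omega>"
    have gv: "g (pattern (val orc (input_mem n \<omega>)) ts) \<longleftrightarrow> ?V \<omega>" if "\<omega> \<in> set_pmf ?R" for \<omega>
    proof
      have I: "tester_input c d N k n G orc \<omega>"
        using set_replicate_uniform[OF that] Gb vG orc by (auto simp: tester_input_def N_def)
      show "g (pattern (val orc (input_mem n \<omega>)) ts)" if "?V \<omega>"
        unfolding g_def
        by (rule exI[of _ n], rule exI[of _ G], rule exI[of _ orc], rule exI[of _ \<omega>]) (simp add: I that)
      assume "g (pattern (val orc (input_mem n \<omega>)) ts)"
      then obtain n' G' orc' \<omega>' where I': "tester_input c d N k n' G' orc' \<omega>'"
        and pt: "pattern (val orc' (input_mem n' \<omega>')) ts = pattern (val orc (input_mem n \<omega>)) ts"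
        and v: "verdict c d \<phi> N n' G' \<omega>'"
        unfolding g_def by blast
      \<comment> \<open>The input that witnesses \<open>g\<close> may be a graph unrelated to
        \<open>G\<close>; what they share is the pattern.\<close>
      have "verdict c d \<phi> N n' G' \<omega>' \<longleftrightarrow> ?V \<omega>"
        by (rule verdict_pattern[OF I' I Q_def Q]) (rule pattern_eqD[OF pt]; simp add: ts)
      then show "?V \<omega>" using v by simp
    qed
    have acc: "measure_pmf.prob (run orc p T (initial n)) {s. accepting p s} = measure_pmf.prob ?R {\<omega>. ?V \<omega>}"
      unfolding p[of orc n, THEN conjunct2, THEN conjunct1]
      by (intro antisym prob_mono_AE) (simp_all add: gv)
    have rej: "measure_pmf.prob (run orc p T (initial n)) {s. rejecting p s} = measure_pmf.prob ?R {\<omega>. \<not> ?V \<omega>}"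
      unfolding p[of orc n, THEN conjunct2, THEN conjunct2]
      by (intro antisym prob_mono_AE) (simp_all add: gv)
    have neg: "measure_pmf.prob ?R {\<omega>. \<not> ?V \<omega>} = 1 - measure_pmf.prob ?R {\<omega>. ?V \<omega>}"
    proof -
      have "{\<omega>. \<not> ?V \<omega>} = UNIV - {\<omega>. ?V \<omega>}" by auto
      then show ?thesis using measure_pmf.prob_compl[of "{\<omega>. ?V \<omega>}" ?R] by simp
    qed
    have "2 / 3 \<le> measure_pmf.prob ?R {\<omega>. ?V \<omega>}" if "G \<in> ?P"
    proof (cases "n < N")
      case True
      then have "{\<omega>. ?V \<omega>} = UNIV" using that by (simp add: verdict_def)
      then show ?thesis by simp
    next
      case False
      then show ?thesis
        by (intro verdict_complete[OF assms that vG]) (simp_all add: N_def m_def)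
    qed
    moreover have "measure_pmf.prob ?R {\<omega>. ?V \<omega>} \<le> 1 / 3" if far: "eps_far \<epsilon> d G ?P"
    proof (cases "n < N")
      case True
      \<comment> \<open>Below \<open>N\<close> the verdict is exact membership, and a member has
        distance 0 to itself.\<close>
      have "G \<notin> ?P" using eps_far_not_mem[OF bounded_component_graphsD(1)[OF Gb] _ far] \<epsilon> by simp
      then have "{\<omega>. ?V \<omega>} = {}" using True by (simp add: verdict_def)
      then show ?thesis by simp
    next
      case False
      have "8 * (real m + 1)\<^sup>2 * real (c * (qdepth \<phi> + modulus \<phi> * fact c)) / \<epsilon> \<le> real N"
        unfolding N_def by linarith
      also have "\<dots> \<le> real n" using False by simp
      finally have n1: "8 * (real m + 1)\<^sup>2 * real (c * (qdepth \<phi> + modulus \<phi> * fact c)) / \<epsilon> \<le> real n" .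
      have "0 < n" "N \<le> n" using False by (auto simp: N_def)
      then show ?thesis by (rule verdict_sound[OF assms Gb vG _ _ \<epsilon> far m_def \<delta>_def n1 k])
    qed
    ultimately show ?thesis
      using p[of orc n, THEN conjunct1] unfolding acc rej neg by auto
  qed
  then show "\<exists>p T. \<forall>n G orc.
          G \<in> bounded_component_graphs c d \<and> verts G = {1..n} \<and> oracle_for d G orc \<longrightarrow>
          (\<forall>s\<in>set_pmf (run orc p T (initial n)). accepting p s \<or> rejecting p s) \<and>
          (G \<in> ?P \<longrightarrow> measure_pmf.prob (run orc p T (initial n)) {s. accepting p s} \<ge> 2 / 3) \<and>
          (eps_far \<epsilon> d G ?P \<longrightarrow>
             measure_pmf.prob (run orc p T (initial n)) {s. rejecting p s} \<ge> 2 / 3)"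
    by (intro exI[of _ p] exI[of _ T] allI impI) (elim conjE)
qed

end
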